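(* Let $k\ge 2$ and let $T$ be a $k$-uniform hypertree of order $n$, where $T\not\cong S_{n,k}$ and $\frac{n-1}{k-1}\ge 3$. Then $\rho(T)\ge\rho(D_{n,1})$, with equality if and only if $T\cong D_{n,1}$.
   Context: All hypergraphs are finite. A hypergraph $G$ consists of a nonempty vertex set $V(G)$ and an edge set $E(G)$ whose elements are nonempty subsets of $V(G)$. It is $k$-uniform ($k\ge 2$) if every edge has exactly $k$ vertices. A walk of length $p$ from $u$ to $v$ is a sequence $(v_0,e_1,v_1,\dots,v_{p-1},e_p,v_p)$ with $v_0=u$, $v_p=v$, each $e_i$ an edge containing $v_{i-1}$ and $v_i$, and $v_{i-1}\ne v_i$. A path is a walk with all $v_i$ distinct and all $e_i$ distinct; a single vertex is a path of length $0$. A cycle is a walk with at least two edges in which all $e_i$ are distinct and all $v_i$ are distinct except that the first and last vertices coincide. $G$ is connected if there is a path between any two vertices. A hypertree is a connected hypergraph with no cycles; a $k$-uniform hypertree with $m$ edges has order $n=1+(k-1)m$. For connected $G$, the distance $d_G(u,v)$ is the length of a shortest path from $u$ to $v$ (with $d_G(u,u)=0$), the distance matrix is $D(G)=(d_G(u,v))_{u,v\in V(G)}$, and the distance spectral radius $\rho(G)$ is the largest eigenvalue of $D(G)$. The hyperstar $S_{n,k}$ of order $n=1+(k-1)m$ with center $u$ is the $k$-uniform hypertree whose vertex set is a disjoint union $\{u\}\cup V_1\cup\dots\cup V_m$ with $|V_1|=\dots=|V_m|=k-1$ and whose edges are $\{u\}\cup V_i$, $1\le i\le m$ (when $m=1$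 any vertex may serve as the center). For $\frac{n-1}{k-1}\ge 3$ and $1\le a\le\left\lfloor\frac{n-k}{2(k-1)}\right\rfloor$, $D_{n,a}$ is the $k$-uniform hypertree of order $n$ obtained from vertex-disjoint hyperstars $S_{a(k-1)+1,k}$ with center $u$ and $S_{n-k-a(k-1)+1,k}$ with center $v$ by adding $k-2$ new vertices $w_1,\dots,w_{k-2}$ and the edge $\{u,v,w_1,\dots,w_{k-2}\}$. The theorem concerns $a=1$. *)

theory Defs
  imports "Jordan_Normal_Form.Char_Poly"
begin

datatype 'a hypergraph = Hypergraph (hverts: "'a set") (hedges: "'a set set")

definition hypergraph :: "'a hypergraph \<Rightarrow> bool" where
  "hypergraph G \<longleftrightarrow> finite (hverts G) \<and> hverts G \<noteq> {} \<and>
     (\<forall>e\<in>hedges G. e \<noteq> {} \<and> e \<subseteq> hverts G)"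

definition k_uniform :: "nat \<Rightarrow> 'a hypergraph \<Rightarrow> bool" where
  "k_uniform k G \<longleftrightarrow> (\<forall>e\<in>hedges G. card e = k)"

definition hg_iso :: "'a hypergraph \<Rightarrow> 'b hypergraph \<Rightarrow> bool" where
  "hg_iso G H \<longleftrightarrow>
     (\<exists>f. bij_betw f (hverts G) (hverts H) \<and> (\<lambda>e. f ` e) ` hedges G = hedges H)"


text \<open>
  The walk \<open>(v\<^sub>0, e\<^sub>1, v\<^sub>1, \<dots>, e\<^sub>p, v\<^sub>p)\<close> is split into its vertex list \<open>[v\<^sub>0, \<dots>, v\<^sub>p]\<close> and its
  edge list \<open>[e\<^sub>1, \<dots>, e\<^sub>p]\<close>, so \<open>e\<^sub>i\<^sub>+\<^sub>1\<close> is \<open>es ! i\<close>.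
\<close>

definition hg_walk :: "'a hypergraph \<Rightarrow> 'a \<Rightarrow> 'a list \<Rightarrow> 'a set list \<Rightarrow> 'a \<Rightarrow> bool" where
  "hg_walk G u vs es v \<longleftrightarrow>
     length vs = Suc (length es) \<and> set vs \<subseteq> hverts G \<and> hd vs = u \<and> last vs = v \<and>
     (\<forall>i<length es. es ! i \<in> hedges G \<and> vs ! i \<in> es ! i \<and> vs ! Suc i \<in> es ! i \<and>
                    vs ! i \<noteq> vs ! Suc i)"

definition hg_path :: "'a hypergraph \<Rightarrow> 'a \<Rightarrow> 'a list \<Rightarrow> 'a set list \<Rightarrow> 'a \<Rightarrow> bool" where
  "hg_path G u vs es v \<longleftrightarrow> hg_walk G u vs es v \<and> distinct vs \<and> distinct es"

text \<open>Two edges sharing two vertices already give a cycle of length two.\<close>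

definition hg_cycle :: "'a hypergraph \<Rightarrow> 'a list \<Rightarrow> 'a set list \<Rightarrow> bool" where
  "hg_cycle G vs es \<longleftrightarrow>
     (\<exists>u. hg_walk G u vs es u) \<and> length es \<ge> 2 \<and> distinct es \<and> distinct (butlast vs)"

definition hg_connected :: "'a hypergraph \<Rightarrow> bool" where
  "hg_connected G \<longleftrightarrow> (\<forall>u\<in>hverts G. \<forall>v\<in>hverts G. \<exists>vs es. hg_path G u vs es v)"

definition hypertree :: "'a hypergraph \<Rightarrow> bool" where
  "hypertree G \<longleftrightarrow> hypergraph G \<and> hg_connected G \<and> (\<nexists>vs es. hg_cycle G vs es)"


definition hg_distance :: "'a hypergraph \<Rightarrow> 'a \<Rightarrow> 'a \<Rightarrow> nat" where
  "hg_distance G u v = (LEAST p. \<exists>vs es. hg_path G u vs es v \<and> length es = p)"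

text \<open>
  Matrices are indexed by natural numbers, so rows and columns follow some enumeration of the
  vertices. Another enumeration conjugates the matrix by a permutation matrix and leaves the
  eigenvalues unchanged.
\<close>

definition vertex_list :: "'a hypergraph \<Rightarrow> 'a list" where
  "vertex_list G = (SOME xs. distinct xs \<and> set xs = hverts G)"

definition distance_matrix :: "'a hypergraph \<Rightarrow> real mat" where
  "distance_matrix G =
     (let xs = vertex_list G; n = length xs
      in mat n n (\<lambda>(i, j). real (hg_distance G (xs ! i) (xs ! j))))"

text \<open>
  The distance matrix is real symmetric, so all its eigenvalues are real and the maximum
  ranges over a finite nonempty set.
\<close>

definition distance_spectral_radius :: "'a hypergraph \<Rightarrow> real" where
  "distance_spectral_radius G = Max {r. eigenvalue (distance_matrix G) r}"


text \<open>The petal \<open>V\<^sub>i\<close> of a hyperstar consists of the vertices \<open>Leaf i j\<close> with \<open>j < k - 1\<close>.\<close>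

datatype star_vertex = Center | Leaf nat nat

definition petal :: "nat \<Rightarrow> nat \<Rightarrow> star_vertex set" where
  "petal k i = Leaf i ` {..<k - 1}"

text \<open>\<open>hyperstar n k\<close> is meant for \<open>k \<ge> 2\<close> and orders \<open>n = 1 + (k - 1) * m\<close>; it has \<open>m\<close> edges.\<close>

definition hyperstar :: "nat \<Rightarrow> nat \<Rightarrow> star_vertex hypergraph" where
  "hyperstar n k =
     (let m = (n - 1) div (k - 1)
      in Hypergraph (insert Center (\<Union>i<m. petal k i)) ((\<lambda>i. insert Center (petal k i)) ` {..<m}))"

text \<open>
  Vertices of \<open>D\<^sub>n\<^sub>,\<^sub>a\<close>: \<open>StarU\<close> and \<open>StarV\<close> tag the disjoint copies of the two hyperstars (hence
  \<open>u = StarU Center\<close> and \<open>v = StarV Center\<close>), and \<open>W j\<close> for \<open>j < k - 2\<close> are the new vertices.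
\<close>

datatype D_vertex = StarU star_vertex | StarV star_vertex | W nat

text \<open>
  The subtractions are exact for \<open>a \<le> (n - k) div (2 * (k - 1))\<close> and \<open>n \<ge> k \<ge> 2\<close>.
\<close>

definition D_hypertree :: "nat \<Rightarrow> nat \<Rightarrow> nat \<Rightarrow> D_vertex hypergraph" where
  "D_hypertree n k a =
     (let SU = hyperstar (a * (k - 1) + 1) k;
          SV = hyperstar (n - k - a * (k - 1) + 1) k;
          w = W ` {..<k - 2}
      in Hypergraph
           (StarU ` hverts SU \<union> StarV ` hverts SV \<union> w)
           ((\<lambda>e. StarU ` e) ` hedges SU \<union> (\<lambda>e. StarV ` e) ` hedges SV \<union>
            {{StarU Center, StarV Center} \<union> w}))"

end

theory Submission
  imports Defs "HOL-Analysis.Function_Topology"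
begin

text \<open>
  A hypertree \<open>G\<close> that is no hyperstar has an edge \<open>e\<close> with two vertices \<open>u\<close>, \<open>v\<close> that lie on
  further edges; let the branch at \<open>v\<close> be at least as large as the branch at \<open>u\<close>, and let \<open>g\<close> be
  another edge at \<open>u\<close>. Rooting \<open>G\<close> at \<open>e\<close>, every other edge has a parent vertex, the one closest
  to \<open>e\<close>. Replacing the parent by \<open>v\<close> in every edge except \<open>e\<close> and \<open>g\<close> gives a copy \<open>D\<close> of
  \<open>D\<^sub>n\<^sub>,\<^sub>1\<close> on the vertex set of \<open>G\<close>. For the Perron vector \<open>x\<close> of \<open>D\<close>, the difference of the
  quadratic forms of \<open>G\<close> and \<open>D\<close> at \<open>x\<close> splits into contributions of the moved edges, each positive
  unless the parent already is \<open>v\<close>, by the eigenvalue equations for the five values that \<open>x\<close> takes.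
  The Rayleigh principle concludes.
\<close>

section \<open>The top eigenvalue as a maximal Rayleigh quotient\<close>

text \<open>The distance matrices of \<open>G\<close> and \<open>D\<close> cannot be compared entry
  by entry. A moved vertex in the branch at \<open>u\<close> gets farther from \<open>P\<close>, the
  vertices of \<open>g\<close> other than \<open>u\<close>, and every moved vertex whose parent is
  not \<open>v\<close> loses the adjacency to that parent. These losses must be paid by distances
  that shrink, each weighted by entries of \<open>x\<close>. The dangerous case is the branch at
  \<open>u\<close>: there the payment comes from the vertices in the branch at \<open>v\<close>,
  which is why \<open>v\<close> is the end with the larger branch. If the branch at \<open>u\<close>
  consists of more than \<open>P\<close>, it has at least \<open>2 * (k - 1)\<close> vertices, hence
  so has the branch at \<open>v\<close>, and the set \<open>B\<close> of moved vertices has at least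
  \<open>3 * (k - 1)\<close> elements. This is the numerical input of the decisive inequality
  \<open>\<beta>_bound\<close>. Crude lower bounds on the distances in \<open>G\<close> are enough:
  a vertex at height 2 above \<open>e\<close> already earns what its parent costs, hence the cap on
  heights.\<close>

definition quad_form :: "'a set \<Rightarrow> ('a \<Rightarrow> 'a \<Rightarrow> real) \<Rightarrow> ('a \<Rightarrow> real) \<Rightarrow> real" where
  "quad_form V d x = (\<Sum>y\<in>V. \<Sum>z\<in>V. d y z * x y * x z)"

text \<open>Compactness in the product topology on functions. Values outside \<open>V\<close> would
  be unconstrained on the sphere alone, so the functions are made extensional, that is, the factor
  at each point outside \<open>V\<close> is the singleton \<open>{undefined}\<close>. Neither the
  form nor the norm sees this.\<close>

lemma quad_form_attains_max_on_sphere: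
  assumes "finite V" "V \<noteq> {}"
  obtains x where "(\<Sum>v\<in>V. (x v)\<^sup>2) = 1"
    "\<And>y. (\<Sum>v\<in>V. (y v)\<^sup>2) = 1 \<Longrightarrow> quad_form V d y \<le> quad_form V d x"
proof -
  define K where "K = PiE V (\<lambda>_. {-1..1::real}) \<inter> {x. (\<Sum>v\<in>V. (x v)\<^sup>2) = 1}"
  have restr: "restrict y V \<in> K" if y: "(\<Sum>v\<in>V. (y v)\<^sup>2) = 1" for y
  proof -
    have "y v \<in> {-1..1}" if v: "v \<in> V" for v
    proof -
      have "(y v)\<^sup>2 \<le> (\<Sum>v\<in>V. (y v)\<^sup>2)"
        using assms v by (intro member_le_sum) auto
      then show ?thesis using y by (simp add: abs_square_le_1 abs_le_iff)
    qed
    then show ?thesis using y by (auto simp: K_def)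
  qed
  obtain v0 where v0: "v0 \<in> V" using assms by blast
  have "(\<Sum>v\<in>V. ((if v = v0 then 1 else 0::real))\<^sup>2) = 1"
    using assms v0 by (simp add: if_distrib[of "\<lambda>t. t\<^sup>2"] cong: if_cong)
  from restr[OF this] have ne: "K \<noteq> {}" by blast
  have cont: "continuous_on S (\<lambda>x::'a \<Rightarrow> real. x v)" for S v
    by (rule continuous_on_subset[OF continuous_on_product_coordinates]) simp
  have "compactin (product_topology (\<lambda>_. euclidean) UNIV)
          (PiE UNIV (\<lambda>v. if v \<in> V then {-1..1::real} else {undefined}))"
    by (subst compactin_PiE) auto
  moreover have "PiE UNIV (\<lambda>v. if v \<in> V then {-1..1::real} else {undefined}) = PiE V (\<lambda>_. {-1..1})"
    by (auto simp: PiE_def Pi_def extensional_def split: if_splits)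
  ultimately have "compact (PiE V (\<lambda>_. {-1..1::real}))"
    by (simp add: euclidean_product_topology flip: compactin_euclidean_iff)
  moreover have "closed {x. (\<Sum>v\<in>V. (x v)\<^sup>2) = (1::real)}"
    by (intro closed_Collect_eq continuous_intros cont)
  ultimately have "compact K" unfolding K_def by (rule compact_Int_closed)
  moreover have "continuous_on K (quad_form V d)"
    unfolding quad_form_def by (intro continuous_intros cont)
  ultimately obtain x where x: "x \<in> K" "\<And>y. y \<in> K \<Longrightarrow> quad_form V d y \<le> quad_form V d x"
    using ne continuous_attains_sup by metis
  show ?thesis
  proof
    show "(\<Sum>v\<in>V. (x v)\<^sup>2) = 1" using x(1) by (simp add: K_def)
    fix y :: "'a \<Rightarrow> real" assume "(\<Sum>v\<in>V. (y v)\<^sup>2) = 1"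
    from x(2)[OF restr[OF this]] show "quad_form V d y \<le> quad_form V d x"
      by (simp add: quad_form_def)
  qed
qed

lemma quad_form_scale: "quad_form V d (\<lambda>v. s * x v) = s\<^sup>2 * quad_form V d x"
  by (simp add: quad_form_def sum_distrib_left power2_eq_square mult_ac)

text \<open>A quadratic without constant term that is never negative has its minimum at 0, so its
  derivative vanishes there. The denominator \<open>1 + \<bar>b\<bar>\<close> makes one witness
  serve for every sign of \<open>b\<close>.\<close>

lemma linear_coeff_eq_0:
  fixes a b :: real
  assumes "\<And>t. 0 \<le> 2 * t * a + t\<^sup>2 * b"
  shows "a = 0"
proof (rule ccontr)
  assume a: "a \<noteq> 0"
  define t where "t = - a / (1 + \<bar>b\<bar>)"
  have pos: "1 + \<bar>b\<bar> > 0" by linarith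
  have "2 * t * a + t\<^sup>2 * b = a\<^sup>2 / (1 + \<bar>b\<bar>) * (-2 + b / (1 + \<bar>b\<bar>))"
    by (simp add: t_def power2_eq_square algebra_simps)
  moreover have "b / (1 + \<bar>b\<bar>) \<le> 1" using pos by (simp add: divide_simps)
  moreover have "a\<^sup>2 / (1 + \<bar>b\<bar>) > 0" using a pos by simp
  ultimately have "2 * t * a + t\<^sup>2 * b < 0" by (smt (verit) mult_pos_neg)
  with assms[of t] show False by simp
qed

lemma quad_form_add_single:
  assumes "finite V" "w \<in> V" "\<And>y z. d y z = d z y"
  shows "quad_form V d (\<lambda>v. x v + (if v = w then t else 0))
    = quad_form V d x + 2 * t * (\<Sum>z\<in>V. d w z * x z) + t\<^sup>2 * d w w"
proof -
  have "quad_form V d (\<lambda>v. x v + (if v = w then t else 0)) =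
     (\<Sum>y\<in>V. \<Sum>z\<in>V. d y z * x y * x z + (if z = w then d y z * x y * t else 0)
        + (if y = w then d y z * t * x z else 0) + (if y = w then if z = w then d y z * t * t else 0 else 0))"
    unfolding quad_form_def by (intro sum.cong refl) (auto simp: algebra_simps)
  also have "\<dots> = quad_form V d x + (\<Sum>y\<in>V. d y w * x y * t) + (\<Sum>z\<in>V. d w z * t * x z) + d w w * t * t"
  proof -
    have "(\<Sum>y\<in>V. \<Sum>z\<in>V. if y = w then d y z * t * x z else 0) = (\<Sum>z\<in>V. d w z * t * x z)"
      by (subst sum.swap) (simp add: assms)
    moreover have "(\<Sum>y\<in>V. \<Sum>z\<in>V. if y = w then if z = w then d y z * t * t else 0 else 0)
       = (\<Sum>y\<in>V. if y = w then \<Sum>z\<in>V. if z = w then d y z * t * t else 0 else 0)"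
      by (intro sum.cong refl) auto
    ultimately show ?thesis using assms(1,2) by (simp add: quad_form_def sum.distrib)
  qed
  also have "(\<Sum>y\<in>V. d y w * x y * t) = t * (\<Sum>z\<in>V. d w z * x z)"
    using assms(3) by (simp add: sum_distrib_left mult_ac)
  also have "(\<Sum>z\<in>V. d w z * t * x z) = t * (\<Sum>z\<in>V. d w z * x z)"
    by (simp add: sum_distrib_left mult_ac)
  finally show ?thesis by (simp add: power2_eq_square)
qed

lemma sum_squares_add_single:
  fixes x :: "'a \<Rightarrow> real"
  assumes "finite V" "w \<in> V"
  shows "(\<Sum>v\<in>V. (x v + (if v = w then t else 0))\<^sup>2) = (\<Sum>v\<in>V. (x v)\<^sup>2) + 2 * t * x w + t\<^sup>2"
proof -
  have "(\<Sum>v\<in>V. (x v + (if v = w then t else 0))\<^sup>2)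
      = (\<Sum>v\<in>V. (x v)\<^sup>2 + (if v = w then 2 * t * x v + t\<^sup>2 else 0))"
    by (intro sum.cong refl) (auto simp: power2_eq_square algebra_simps)
  then show ?thesis using assms by (simp add: sum.distrib)
qed

text \<open>The Perron argument in variational form. Since \<open>d\<close> is nonnegative, taking
  absolute values does not decrease the form, so a maximiser on the sphere may be assumed
  nonnegative. Perturbing one coordinate at a time turns maximality into the eigenvalue equation,
  and homogeneity turns it into the Rayleigh bound.\<close>

lemma nonneg_symmetric_top_eigenvector:
  fixes d :: "'a \<Rightarrow> 'a \<Rightarrow> real"
  assumes V: "finite V" "V \<noteq> {}" and sym: "\<And>y z. d y z = d z y" and nn: "\<And>y z. d y z \<ge> 0"
  obtains x r where "\<And>v. x v \<ge> 0" "\<exists>v\<in>V. x v \<noteq> 0"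
    "\<And>w. w \<in> V \<Longrightarrow> (\<Sum>z\<in>V. d w z * x z) = r * x w"
    "\<And>y. quad_form V d y \<le> r * (\<Sum>v\<in>V. (y v)\<^sup>2)"
proof -
  obtain x0 where x0: "(\<Sum>v\<in>V. (x0 v)\<^sup>2) = 1"
    "\<And>y. (\<Sum>v\<in>V. (y v)\<^sup>2) = 1 \<Longrightarrow> quad_form V d y \<le> quad_form V d x0"
    using quad_form_attains_max_on_sphere[OF V] by metis
  define x where "x = (\<lambda>v. \<bar>x0 v\<bar>)"
  define r where "r = quad_form V d x"
  have x1: "(\<Sum>v\<in>V. (x v)\<^sup>2) = 1" using x0(1) by (simp add: x_def)
  have "quad_form V d x0 \<le> r"
    unfolding r_def quad_form_def x_def
  proof (intro sum_mono)
    fix y z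
    have "d y z * (x0 y * x0 z) \<le> d y z * (\<bar>x0 y\<bar> * \<bar>x0 z\<bar>)"
      by (intro mult_left_mono nn) (metis abs_ge_self abs_mult)
    then show "d y z * x0 y * x0 z \<le> d y z * \<bar>x0 y\<bar> * \<bar>x0 z\<bar>" by (simp add: mult.assoc)
  qed
  then have max1: "quad_form V d y \<le> r" if "(\<Sum>v\<in>V. (y v)\<^sup>2) = 1" for y
    using x0(2)[OF that] by linarith
  have max: "quad_form V d y \<le> r * (\<Sum>v\<in>V. (y v)\<^sup>2)" for y
  proof (cases "(\<Sum>v\<in>V. (y v)\<^sup>2) = 0")
    case True
    then have "\<forall>v\<in>V. y v = 0" using V by (simp add: sum_nonneg_eq_0_iff)
    then show ?thesis using True by (simp add: quad_form_def)
  next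
    case False
    define s where "s = (\<Sum>v\<in>V. (y v)\<^sup>2)"
    have s: "s > 0" using False by (simp add: s_def sum_nonneg order_less_le)
    have "(\<Sum>v\<in>V. ((1 / sqrt s) * y v)\<^sup>2) = (1 / s) * s"
      using s by (simp add: power_mult_distrib power_divide s_def flip: sum_divide_distrib)
    also have "\<dots> = 1" using s by simp
    finally have "quad_form V d (\<lambda>v. (1 / sqrt s) * y v) \<le> r" by (rule max1)
    then have "(1 / s) * quad_form V d y \<le> r"
      unfolding quad_form_scale using s by (simp add: power_divide)
    then show ?thesis using s by (simp add: s_def divide_simps mult.commute)
  qed
  have eig: "(\<Sum>z\<in>V. d w z * x z) = r * x w" if w: "w \<in> V" for w
  proof -
    have "r * x w - (\<Sum>z\<in>V. d w z * x z) = 0"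
    proof (rule linear_coeff_eq_0)
      fix t :: real
      have "quad_form V d x + 2 * t * (\<Sum>z\<in>V. d w z * x z) + t\<^sup>2 * d w w \<le> r * (1 + 2 * t * x w + t\<^sup>2)"
        using max[of "\<lambda>v. x v + (if v = w then t else 0)"]
        unfolding quad_form_add_single[where d = d, OF V(1) w sym] sum_squares_add_single[OF V(1) w] x1 .
      then show "0 \<le> 2 * t * (r * x w - (\<Sum>z\<in>V. d w z * x z)) + t\<^sup>2 * (r - d w w)"
        by (simp add: r_def algebra_simps)
    qed
    then show ?thesis by simp
  qed
  have ne: "\<exists>v\<in>V. x v \<noteq> 0"
  proof (rule ccontr)
    assume "\<not> ?thesis"
    then have "(\<Sum>v\<in>V. (x v)\<^sup>2) = 0" by simp
    with x1 show False by simp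
  qed
  have "x v \<ge> 0" for v by (simp add: x_def)
  then show ?thesis using that ne eig max by blast
qed

section \<open>From indexed matrices to functions on vertices\<close>

lemma vertex_list:
  assumes "finite (hverts G)"
  shows "distinct (vertex_list G)" "set (vertex_list G) = hverts G"
  using someI_ex[of "\<lambda>xs. distinct xs \<and> set xs = hverts G"] finite_distinct_list[OF assms]
  unfolding vertex_list_def by blast+

text \<open>Disposes of the arbitrary enumeration: eigenvectors indexed by positions become
  functions on vertices, and the sums are reindexed along the bijection given by the list.\<close>

lemma eigenvalue_distance_matrix_iff:
  assumes fin: "finite (hverts G)"
  shows "eigenvalue (distance_matrix G) r \<longleftrightarrow>
    (\<exists>x. (\<exists>v\<in>hverts G. x v \<noteq> 0) \<and>
      (\<forall>w\<in>hverts G. (\<Sum>z\<in>hverts G. real (hg_distance G w z) * x z) = r * x w))"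
proof -
  define xs where "xs = vertex_list G"
  define n where "n = length xs"
  define A where "A = distance_matrix G"
  have A: "A = mat n n (\<lambda>(i, j). real (hg_distance G (xs ! i) (xs ! j)))"
    by (simp add: A_def distance_matrix_def xs_def n_def Let_def)
  have dx: "distinct xs" "set xs = hverts G" using vertex_list[OF fin] by (simp_all add: xs_def)
  have bij: "bij_betw (\<lambda>i. xs ! i) {..<n} (hverts G)"
    using bij_betw_nth[OF dx(1), of "{..<n}" "hverts G"] dx(2) by (simp add: n_def)
  have row: "(A *\<^sub>v v) $ i = (\<Sum>j<n. real (hg_distance G (xs ! i) (xs ! j)) * v $ j)"
    if "i < n" "dim_vec v = n" for i and v :: "real Matrix.vec"
    using that by (simp add: A scalar_prod_def lessThan_atLeast0)
  show ?thesis
    unfolding A_def[symmetric]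
  proof
    assume "eigenvalue A r"
    then obtain v where v: "v \<in> carrier_vec n" "v \<noteq> 0\<^sub>v n" "A *\<^sub>v v = r \<cdot>\<^sub>v v"
      by (auto simp: eigenvalue_def eigenvector_def A)
    define x where "x = (\<lambda>w. v $ (inv_into {..<n} (\<lambda>i. xs ! i) w))"
    have x: "x (xs ! i) = v $ i" if "i < n" for i
      using that bij by (simp add: x_def bij_betw_def inv_into_f_f)
    show "\<exists>x. (\<exists>v\<in>hverts G. x v \<noteq> 0) \<and>
      (\<forall>w\<in>hverts G. (\<Sum>z\<in>hverts G. real (hg_distance G w z) * x z) = r * x w)"
    proof (intro exI[of _ x] conjI ballI)
      obtain i where "i < n" "v $ i \<noteq> 0" using v(1,2) by (metis carrier_vecD dim_vec eq_vecI index_zero_vec)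
      then show "\<exists>v\<in>hverts G. x v \<noteq> 0" using x dx by (metis n_def nth_mem)
    next
      fix w assume "w \<in> hverts G"
      then obtain i where i: "i < n" "w = xs ! i" using dx by (metis in_set_conv_nth n_def)
      have "(\<Sum>z\<in>hverts G. real (hg_distance G w z) * x z)
          = (\<Sum>j<n. real (hg_distance G w (xs ! j)) * x (xs ! j))"
        by (rule sum.reindex_bij_betw[OF bij, symmetric])
      also have "\<dots> = (A *\<^sub>v v) $ i" using row i v(1) x by simp
      also have "\<dots> = r * x w" using v i x by simp
      finally show "(\<Sum>z\<in>hverts G. real (hg_distance G w z) * x z) = r * x w" .
    qed
  next
    assume "\<exists>x. (\<exists>v\<in>hverts G. x v \<noteq> 0) \<and>
      (\<forall>w\<in>hverts G. (\<Sum>z\<in>hverts G. real (hg_distance G w z) * x z) = r * x w)"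
    then obtain x v0 where x: "v0 \<in> hverts G" "x v0 \<noteq> 0"
      "\<And>w. w \<in> hverts G \<Longrightarrow> (\<Sum>z\<in>hverts G. real (hg_distance G w z) * x z) = r * x w" by blast
    define v where "v = Matrix.vec n (\<lambda>i. x (xs ! i))"
    have "A *\<^sub>v v = r \<cdot>\<^sub>v v"
    proof (rule eq_vecI)
      fix i assume "i < dim_vec (r \<cdot>\<^sub>v v)"
      then have i: "i < n" by (simp add: v_def)
      then have "xs ! i \<in> hverts G" using dx by (metis n_def nth_mem)
      have "(A *\<^sub>v v) $ i = (\<Sum>j<n. real (hg_distance G (xs ! i) (xs ! j)) * x (xs ! j))"
        using row[OF i, of v] by (simp add: v_def)
      also have "\<dots> = (\<Sum>z\<in>hverts G. real (hg_distance G (xs ! i) z) * x z)"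
        by (rule sum.reindex_bij_betw[OF bij])
      also have "\<dots> = r * x (xs ! i)" by (rule x(3)) fact
      finally show "(A *\<^sub>v v) $ i = (r \<cdot>\<^sub>v v) $ i" using i by (simp add: v_def)
    qed (simp add: v_def A)
    moreover have "v \<noteq> 0\<^sub>v n"
    proof
      assume v: "v = 0\<^sub>v n"
      obtain i where i: "i < n" "v0 = xs ! i" using x(1) dx by (metis in_set_conv_nth n_def)
      then have "v $ i = x v0" by (simp add: v_def)
      with v i x(2) show False by simp
    qed
    ultimately show "eigenvalue A r"
      unfolding eigenvalue_def eigenvector_def by (intro exI[of _ v]) (simp add: A v_def)
  qed
qed

definition hg_form :: "'a hypergraph \<Rightarrow> ('a \<Rightarrow> real) \<Rightarrow> real" where
  "hg_form G = quad_form (hverts G) (\<lambda>y z. real (hg_distance G y z))"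

lemma quad_form_eigenvector:
  assumes "\<And>w. w \<in> V \<Longrightarrow> (\<Sum>z\<in>V. d w z * x z) = r * x w"
  shows "quad_form V d x = r * (\<Sum>v\<in>V. (x v)\<^sup>2)"
proof -
  have "quad_form V d x = (\<Sum>y\<in>V. x y * (\<Sum>z\<in>V. d y z * x z))"
    by (simp add: quad_form_def sum_distrib_left mult_ac)
  also have "\<dots> = (\<Sum>y\<in>V. r * (x y)\<^sup>2)"
    using assms by (simp add: power2_eq_square mult_ac)
  finally show ?thesis by (simp add: sum_distrib_left)
qed

lemma quad_form_cong:
  assumes "\<And>y z. y \<in> V \<Longrightarrow> z \<in> V \<Longrightarrow> d y z = d' y z"
  shows "quad_form V d x = quad_form V d' x"
  using assms by (simp add: quad_form_def)

text \<open>Identifies the variational maximum with the \<open>Max\<close> in the definition. Every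
  eigenvalue is the Rayleigh quotient of its eigenvector, hence at most \<open>r\<close>, and
  \<open>r\<close> is attained. \<open>Max\<close> is meaningful because the eigenvalues are roots
  of the characteristic polynomial and so finitely many.\<close>

lemma distance_spectral_radius_Perron:
  assumes V: "finite (hverts G)" "hverts G \<noteq> {}"
    and sym: "\<And>y z. y \<in> hverts G \<Longrightarrow> z \<in> hverts G \<Longrightarrow> hg_distance G y z = hg_distance G z y"
  shows "hg_form G y \<le> distance_spectral_radius G * (\<Sum>v\<in>hverts G. (y v)\<^sup>2)"
    and "\<exists>x. (\<forall>v. x v \<ge> 0) \<and> (\<exists>v\<in>hverts G. x v \<noteq> 0) \<and>
      (\<forall>w\<in>hverts G. (\<Sum>z\<in>hverts G. real (hg_distance G w z) * x z) = distance_spectral_radius G * x w)"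
proof -
  let ?V = "hverts G"
  \<comment> \<open>The variational lemma asks for symmetry everywhere, while the distance is known
    to be symmetric only on the vertex set; the default 0 bridges this.\<close>
  define d where "d = (\<lambda>y z. if y \<in> ?V \<and> z \<in> ?V then real (hg_distance G y z) else 0)"
  have d: "d y z = real (hg_distance G y z)" if "y \<in> ?V" "z \<in> ?V" for y z
    using that by (simp add: d_def)
  have form: "hg_form G = quad_form ?V d"
    unfolding hg_form_def by (intro ext quad_form_cong) (simp add: d)
  obtain x r where xr: "\<And>v. x v \<ge> 0" "\<exists>v\<in>?V. x v \<noteq> 0"
    "\<And>w. w \<in> ?V \<Longrightarrow> (\<Sum>z\<in>?V. d w z * x z) = r * x w"
    "\<And>y. quad_form ?V d y \<le> r * (\<Sum>v\<in>?V. (y v)\<^sup>2)"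
  proof (rule nonneg_symmetric_top_eigenvector[OF V, of d])
    show "d y z = d z y" for y z by (simp add: d_def sym)
    show "d y z \<ge> 0" for y z by (simp add: d_def)
  qed (rule that)
  have eq: "(\<Sum>z\<in>?V. real (hg_distance G w z) * x z) = r * x w" if "w \<in> ?V" for w
    using xr(3)[OF that] d that by simp
  have ev: "eigenvalue (distance_matrix G) r"
    unfolding eigenvalue_distance_matrix_iff[OF V(1)] using xr(2) eq by blast
  have le: "s \<le> r" if s: "eigenvalue (distance_matrix G) s" for s
  proof -
    obtain y where y: "\<exists>v\<in>?V. y v \<noteq> 0"
      "\<And>w. w \<in> ?V \<Longrightarrow> (\<Sum>z\<in>?V. real (hg_distance G w z) * y z) = s * y w"
      using s unfolding eigenvalue_distance_matrix_iff[OF V(1)] by blast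
    have pos: "(\<Sum>v\<in>?V. (y v)\<^sup>2) > 0"
      using y(1) V(1) by (metis sum_pos2 zero_le_power2 zero_less_power2)
    have "s * (\<Sum>v\<in>?V. (y v)\<^sup>2) = hg_form G y"
      unfolding hg_form_def using quad_form_eigenvector[OF y(2)] by simp
    also have "\<dots> \<le> r * (\<Sum>v\<in>?V. (y v)\<^sup>2)" unfolding form by (rule xr(4))
    finally show ?thesis using pos by simp
  qed
  have "finite {s. eigenvalue (distance_matrix G) s}"
  proof -
    have A: "distance_matrix G \<in> carrier_mat (length (vertex_list G)) (length (vertex_list G))"
      by (simp add: distance_matrix_def Let_def)
    have "{s. eigenvalue (distance_matrix G) s} = {s. poly (char_poly (distance_matrix G)) s = 0}"
      using eigenvalue_root_char_poly[OF A] by simp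
    moreover have "char_poly (distance_matrix G) \<noteq> 0"
      using degree_monic_char_poly[OF A] by auto
    ultimately show ?thesis using poly_roots_finite by metis
  qed
  then have r: "distance_spectral_radius G = r"
    unfolding distance_spectral_radius_def using ev le by (intro Max_eqI) auto
  show "hg_form G y \<le> distance_spectral_radius G * (\<Sum>v\<in>?V. (y v)\<^sup>2)"
    unfolding r form by (rule xr(4))
  show "\<exists>x. (\<forall>v. x v \<ge> 0) \<and> (\<exists>v\<in>?V. x v \<noteq> 0) \<and>
      (\<forall>w\<in>?V. (\<Sum>z\<in>?V. real (hg_distance G w z) * x z) = distance_spectral_radius G * x w)"
    unfolding r using xr(1,2) eq by blast
qed

section \<open>Distances and isomorphisms\<close>

text \<open>The parameter is an edge set rather than a hypergraph, so that single edges can be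
  deleted while the vertices stay.\<close>

definition hadj :: "'a set set \<Rightarrow> 'a rel" where
  "hadj E = {(y, z). y \<noteq> z \<and> (\<exists>f\<in>E. y \<in> f \<and> z \<in> f)}"

lemma hadjI: "f \<in> E \<Longrightarrow> y \<in> f \<Longrightarrow> z \<in> f \<Longrightarrow> y \<noteq> z \<Longrightarrow> (y, z) \<in> hadj E"
  by (auto simp: hadj_def)

lemma sym_hadj: "sym (hadj E)"
  by (auto simp: hadj_def sym_def)

lemma sym_relpow: "sym r \<Longrightarrow> (y, z) \<in> r ^^ n \<Longrightarrow> (z, y) \<in> r ^^ n"
proof (induction n arbitrary: z)
  case (Suc n)
  then obtain w where "(y, w) \<in> r ^^ n" "(w, z) \<in> r" by auto
  then show ?case using Suc.IH[OF Suc.prems(1)] symD[OF Suc.prems(1)] by (meson relpow_Suc_I2)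
qed simp

lemma hadj_rtrancl_sym: "(y, z) \<in> (hadj E)\<^sup>* \<Longrightarrow> (z, y) \<in> (hadj E)\<^sup>*"
  by (meson sym_hadj sym_rtrancl symD)

lemma hadj_rtranclI: "f \<in> E \<Longrightarrow> y \<in> f \<Longrightarrow> z \<in> f \<Longrightarrow> (y, z) \<in> (hadj E)\<^sup>*"
  by (cases "y = z") (auto intro: hadjI)

text \<open>In a shortest chain, a repeated vertex or a repeated edge would yield a shortcut. Hence
  the distinctness required of paths comes for free.\<close>

lemma hadj_geodesic:
  assumes "(u, v) \<in> hadj E ^^ n" and min: "\<And>m. m < n \<Longrightarrow> (u, v) \<notin> hadj E ^^ m"
  obtains s t where "s 0 = u" "s n = v" "inj_on s {..n}" "inj_on t {..<n}"
    "\<And>i. i < n \<Longrightarrow> t i \<in> E \<and> s i \<in> t i \<and> s (Suc i) \<in> t i \<and> s i \<noteq> s (Suc i)"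
proof -
  obtain s where s: "s 0 = u" "s n = v" "\<And>i. i < n \<Longrightarrow> (s i, s (Suc i)) \<in> hadj E"
    using assms(1) unfolding relpow_fun_conv by blast
  then have "\<forall>i. \<exists>f. i < n \<longrightarrow> f \<in> E \<and> s i \<in> f \<and> s (Suc i) \<in> f \<and> s i \<noteq> s (Suc i)"
    by (auto simp: hadj_def)
  then obtain t where t: "\<And>i. i < n \<Longrightarrow> t i \<in> E \<and> s i \<in> t i \<and> s (Suc i) \<in> t i \<and> s i \<noteq> s (Suc i)"
    by metis
  have no_shortcut: "(s i, s j) \<notin> hadj E ^^ m" if "i \<le> j" "j \<le> n" "m < j - i" for i j m
  proof
    assume m: "(s i, s j) \<in> hadj E ^^ m"
    have seg: "(s a, s (a + b)) \<in> hadj E ^^ b" if "a + b \<le> n" for a b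
      unfolding relpow_fun_conv using s(3) that by (intro exI[of _ "\<lambda>i. s (a + i)"]) auto
    have "(s 0, s n) \<in> (hadj E ^^ i O hadj E ^^ m) O hadj E ^^ (n - j)"
      using seg[of 0 i] m seg[of j "n - j"] that by auto
    then have "(u, v) \<in> hadj E ^^ (i + m + (n - j))" by (simp add: relpow_add s)
    then show False using min[of "i + m + (n - j)"] that by linarith
  qed
  have "inj_on s {..n}"
  proof (rule linorder_inj_onI)
    fix i j assume "i < j" "i \<in> {..n}" "j \<in> {..n}"
    then show "s i \<noteq> s j" using no_shortcut[of i j 0] by auto
  qed auto
  moreover have "inj_on t {..<n}"
  proof (rule linorder_inj_onI)
    fix i j assume ij: "i < j" "i \<in> {..<n}" "j \<in> {..<n}"
    show "t i \<noteq> t j"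
    proof
      \<comment> \<open>One edge contains both \<open>s i\<close> and \<open>s (Suc j)\<close>, so
        at most one step replaces at least two.\<close>
      assume "t i = t j"
      then have "s i = s (Suc j) \<or> (s i, s (Suc j)) \<in> hadj E ^^ 1"
        using t[of i] t[of j] ij by (auto intro!: hadjI)
      then show False
        using no_shortcut[of i "Suc j" 0] no_shortcut[of i "Suc j" 1] ij by auto
    qed
  qed auto
  ultimately show ?thesis using that s t by blast
qed

lemma walk_imp_relpow:
  assumes "hg_walk G u vs es v"
  shows "(u, v) \<in> hadj (hedges G) ^^ length es"
  unfolding relpow_fun_conv
proof (intro exI[of _ "\<lambda>i. vs ! i"] conjI allI impI)
  have "vs \<noteq> []" using assms by (auto simp: hg_walk_def)
  then show "vs ! 0 = u" "vs ! length es = v"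
    using assms by (auto simp: hg_walk_def hd_conv_nth last_conv_nth)
  fix i assume "i < length es"
  then show "(vs ! i, vs ! Suc i) \<in> hadj (hedges G)"
    using assms by (auto simp: hg_walk_def intro: hadjI)
qed

lemma geodesic_walk:
  assumes G: "hypergraph G" and u: "u \<in> hverts G" and E: "E \<subseteq> hedges G"
    and uv: "(u, v) \<in> hadj E ^^ n" "\<And>m. m < n \<Longrightarrow> (u, v) \<notin> hadj E ^^ m"
  obtains vs es where "hg_path G u vs es v" "length es = n" "set es \<subseteq> E"
proof -
  obtain s t where st: "s 0 = u" "s n = v" "inj_on s {..n}" "inj_on t {..<n}"
    "\<And>i. i < n \<Longrightarrow> t i \<in> E \<and> s i \<in> t i \<and> s (Suc i) \<in> t i \<and> s i \<noteq> s (Suc i)"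
    using hadj_geodesic[OF uv] by metis
  have "s i \<in> hverts G" if "i \<le> n" for i
    using that G u E st(1,5) by (cases i) (auto simp: hypergraph_def subset_iff less_eq_Suc_le)
  then have "set (map s [0..<Suc n]) \<subseteq> hverts G" by auto
  moreover have "map s [0..<Suc n] ! i = s i" if "i \<le> n" for i
    using that by (simp del: upt_Suc)
  ultimately have "hg_walk G u (map s [0..<Suc n]) (map t [0..<n]) v"
    using st(1,2,5) E unfolding hg_walk_def by (auto simp: hd_map last_map simp del: upt_Suc)
  moreover have "distinct (map s [0..<Suc n])"
    using st(3) by (simp add: distinct_map lessThan_atLeast0 atLeastLessThanSuc_atLeastAtMost
        atMost_atLeast0 del: upt_Suc)
  moreover have "distinct (map t [0..<n])"
    using st(4) by (simp add: distinct_map lessThan_atLeast0)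
  ultimately have "hg_path G u (map s [0..<Suc n]) (map t [0..<n]) v"
    by (simp add: hg_path_def del: upt_Suc)
  moreover have "set (map t [0..<n]) \<subseteq> E" using st(5) by auto
  ultimately show ?thesis using that[of "map s [0..<Suc n]" "map t [0..<n]"] by simp
qed

text \<open>Shortest walks are paths, so minimising over paths and minimising over relation powers
  agree. If \<open>v\<close> cannot be reached, both sides are the \<open>LEAST\<close> of the same
  empty predicate, which is why nothing is demanded of \<open>v\<close>.\<close>

lemma hg_distance_eq:
  assumes G: "hypergraph G" and u: "u \<in> hverts G"
  shows "hg_distance G u v = (LEAST n. (u, v) \<in> hadj (hedges G) ^^ n)"
proof (cases "\<exists>n. (u, v) \<in> hadj (hedges G) ^^ n")
  case True
  define n where "n = (LEAST n. (u, v) \<in> hadj (hedges G) ^^ n)"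
  have n: "(u, v) \<in> hadj (hedges G) ^^ n" using True unfolding n_def by (rule LeastI_ex)
  have min: "(u, v) \<notin> hadj (hedges G) ^^ m" if "m < n" for m
    using that not_less_Least unfolding n_def by blast
  obtain vs es where "hg_path G u vs es v" "length es = n"
    using geodesic_walk[OF G u order_refl n min] by metis
  moreover have "n \<le> length es'" if "hg_path G u vs' es' v" for vs' es'
    using walk_imp_relpow[of G u vs' es' v] min that by (meson hg_path_def not_le)
  ultimately have "hg_distance G u v = n"
    unfolding hg_distance_def by (intro Least_equality) auto
  then show ?thesis by (simp add: n_def)
next
  case False
  then have no: "\<not> (\<exists>vs es. hg_path G u vs es v \<and> length es = p)" for p
    using False by (meson hg_path_def walk_imp_relpow)
  have "(\<lambda>p. \<exists>vs es. hg_path G u vs es v \<and> length es = p) = (\<lambda>n. (u, v) \<in> hadj (hedges G) ^^ n)"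
    using no False by blast
  then show ?thesis unfolding hg_distance_def by simp
qed

lemma hg_distance_sym:
  assumes "hypergraph G" "u \<in> hverts G" "v \<in> hverts G"
  shows "hg_distance G u v = hg_distance G v u"
proof -
  have "(u, v) \<in> hadj (hedges G) ^^ n \<longleftrightarrow> (v, u) \<in> hadj (hedges G) ^^ n" for n
    by (auto intro: sym_relpow[OF sym_hadj])
  then show ?thesis using assms by (simp add: hg_distance_eq)
qed

lemma relpow_hg_distance:
  assumes "hypergraph G" "u \<in> hverts G" "(u, v) \<in> (hadj (hedges G))\<^sup>*"
  shows "(u, v) \<in> hadj (hedges G) ^^ hg_distance G u v"
  using assms by (auto simp: hg_distance_eq rtrancl_power intro: LeastI)

text \<open>The tool for lower bounds on distances: a label that rises by at most 1 along each
  adjacency replaces an analysis of individual paths.\<close>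

lemma relpow_potential:
  fixes \<phi> :: "'a \<Rightarrow> int"
  assumes "(y, z) \<in> r ^^ n" "\<And>a b. (a, b) \<in> r \<Longrightarrow> \<phi> b \<le> \<phi> a + 1"
  shows "\<phi> z \<le> \<phi> y + int n"
  using assms(1) by (induction n arbitrary: z) (fastforce dest: assms(2))+

section \<open>Invariance of distances and spectra under isomorphism\<close>

lemma hadj_relpow_image:
  assumes "(u, v) \<in> hadj E ^^ n" "inj_on f V" "\<And>e. e \<in> E \<Longrightarrow> e \<subseteq> V"
  shows "(f u, f v) \<in> hadj ((\<lambda>e. f ` e) ` E) ^^ n"
  using assms(1)
proof (induction n arbitrary: v)
  case (Suc n)
  then obtain w where w: "(u, w) \<in> hadj E ^^ n" "(w, v) \<in> hadj E" by auto
  then obtain g where g: "g \<in> E" "w \<in> g" "v \<in> g" "w \<noteq> v" by (auto simp: hadj_def)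
  then have "f w \<noteq> f v" using assms(2) assms(3)[of g] by (auto simp: inj_on_def)
  then have "(f w, f v) \<in> hadj ((\<lambda>e. f ` e) ` E)" using g by (intro hadjI[of "f ` g"]) auto
  with Suc.IH[OF w(1)] show ?case by auto
qed simp

lemma image_inv_into_edges:
  assumes "bij_betw f V U" "\<And>e. e \<in> E \<Longrightarrow> e \<subseteq> V"
  shows "(\<lambda>e. inv_into V f ` e) ` (\<lambda>e. f ` e) ` E = E"
proof -
  have "inv_into V f ` f ` e = e" if "e \<in> E" for e
    using assms(1) assms(2)[OF that] by (simp add: bij_betw_def image_inv_into_cancel inv_into_image_cancel)
  then show ?thesis by (auto simp: image_image)
qed

lemma hg_iso_sym:
  assumes G: "hypergraph G" and iso: "hg_iso G H"
  shows "hg_iso H G"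
proof -
  obtain f where f: "bij_betw f (hverts G) (hverts H)" "(\<lambda>e. f ` e) ` hedges G = hedges H"
    using iso by (auto simp: hg_iso_def)
  have "(\<lambda>e. inv_into (hverts G) f ` e) ` hedges H = hedges G"
    unfolding f(2)[symmetric] using G by (intro image_inv_into_edges[OF f(1)]) (auto simp: hypergraph_def)
  then show ?thesis using bij_betw_inv_into[OF f(1)] unfolding hg_iso_def by blast
qed

lemma hypergraph_iso:
  assumes "hypergraph G" "hg_iso G H"
  shows "hypergraph H"
proof -
  obtain f where f: "bij_betw f (hverts G) (hverts H)" "(\<lambda>e. f ` e) ` hedges G = hedges H"
    using assms by (auto simp: hg_iso_def)
  then have "f ` hverts G = hverts H" by (simp add: bij_betw_def)
  then show ?thesis using assms(1) f(2) unfolding hypergraph_def by (metis (no_types, lifting) finite_imageI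
        image_iff image_is_empty image_mono)
qed

lemma hg_distance_iso:
  assumes G: "hypergraph G" and f: "bij_betw f (hverts G) (hverts H)" "(\<lambda>e. f ` e) ` hedges G = hedges H"
    and uv: "u \<in> hverts G" "v \<in> hverts G"
  shows "hg_distance H (f u) (f v) = hg_distance G u v"
proof -
  have sub: "e \<subseteq> hverts G" if "e \<in> hedges G" for e using G that by (auto simp: hypergraph_def)
  have inj: "inj_on f (hverts G)" "f ` hverts G = hverts H" using f(1) by (auto simp: bij_betw_def)
  have H: "hypergraph H" using hypergraph_iso[OF G] f by (auto simp: hg_iso_def)
  let ?g = "inv_into (hverts G) f"
  have "(u, v) \<in> hadj (hedges G) ^^ n \<longleftrightarrow> (f u, f v) \<in> hadj (hedges H) ^^ n" for n
  proof
    show "(f u, f v) \<in> hadj (hedges H) ^^ n" if "(u, v) \<in> hadj (hedges G) ^^ n"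
      using hadj_relpow_image[OF that inj(1) sub] f(2) by simp
    assume "(f u, f v) \<in> hadj (hedges H) ^^ n"
    then have "(?g (f u), ?g (f v)) \<in> hadj ((\<lambda>e. ?g ` e) ` hedges H) ^^ n"
      using H bij_betw_inv_into[OF f(1)]
      by (intro hadj_relpow_image[where V = "hverts H"]) (auto simp: bij_betw_def hypergraph_def)
    then show "(u, v) \<in> hadj (hedges G) ^^ n"
      using image_inv_into_edges[OF f(1), of "hedges G"] sub f(2) inj uv by simp
  qed
  then show ?thesis using G H uv inj by (subst (1 2) hg_distance_eq) auto
qed

lemma distance_spectral_radius_iso:
  assumes G: "hypergraph G" and iso: "hg_iso G H"
  shows "distance_spectral_radius G = distance_spectral_radius H"
proof -
  \<comment> \<open>One inclusion between the spectra, for arbitrary vertex types, so that it can be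
    applied to the isomorphism and to its inverse.\<close>
  have "eigenvalue (distance_matrix G1) r"
    if G: "hypergraph G1" and iso: "hg_iso G1 H1" and ev: "eigenvalue (distance_matrix H1) r"
    for r and G1 :: "'c hypergraph" and H1 :: "'d hypergraph"
  proof -
    obtain f where f: "bij_betw f (hverts G1) (hverts H1)" "(\<lambda>e. f ` e) ` hedges G1 = hedges H1"
      using iso by (auto simp: hg_iso_def)
    have fin: "finite (hverts G1)" "finite (hverts H1)"
      using G hypergraph_iso[OF G iso] by (auto simp: hypergraph_def)
    obtain x where x: "\<exists>v\<in>hverts H1. x v \<noteq> 0"
      "\<And>w. w \<in> hverts H1 \<Longrightarrow> (\<Sum>z\<in>hverts H1. real (hg_distance H1 w z) * x z) = r * x w"
      using ev eigenvalue_distance_matrix_iff[OF fin(2)] by blast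
    have im: "f ` hverts G1 = hverts H1" using f(1) by (simp add: bij_betw_def)
    have "(\<Sum>z\<in>hverts G1. real (hg_distance G1 w z) * x (f z)) = r * x (f w)" if w: "w \<in> hverts G1" for w
    proof -
      have "(\<Sum>z\<in>hverts G1. real (hg_distance G1 w z) * x (f z))
          = (\<Sum>z\<in>hverts G1. real (hg_distance H1 (f w) (f z)) * x (f z))"
        using hg_distance_iso[OF G f w] by (intro sum.cong) simp_all
      also have "\<dots> = (\<Sum>z\<in>hverts H1. real (hg_distance H1 (f w) z) * x z)"
        by (rule sum.reindex_bij_betw[OF f(1)])
      finally show ?thesis using x(2) w im by auto
    qed
    moreover have "\<exists>v\<in>hverts G1. x (f v) \<noteq> 0" using x(1) im by (metis imageE)
    ultimately show ?thesis
      unfolding eigenvalue_distance_matrix_iff[OF fin(1)] by (intro exI[of _ "x \<circ> f"]) auto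
  qed note * = this
  show ?thesis
    unfolding distance_spectral_radius_def
    by (rule arg_cong[where f = Max])
      (use *[OF G iso] *[OF hypergraph_iso[OF G iso] hg_iso_sym[OF G iso]] in blast)
qed

section \<open>Hypertrees rooted at an edge\<close>

lemma hadj_mono: "E \<subseteq> F \<Longrightarrow> hadj E \<subseteq> hadj F"
  by (auto simp: hadj_def)

lemma hadj_rtrancl_mono: "(a, b) \<in> (hadj E)\<^sup>* \<Longrightarrow> E \<subseteq> F \<Longrightarrow> (a, b) \<in> (hadj F)\<^sup>*"
  using rtrancl_mono[OF hadj_mono] by blast

lemma hadj_step_cases:
  assumes "(a, b) \<in> hadj E"
  obtains "(a, b) \<in> hadj (E - {f})" | "a \<in> f" "b \<in> f"
  using assms by (auto simp: hadj_def)

text \<open>Cut the walk just before its first step through \<open>f\<close>: the vertex reached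
  there lies in \<open>f\<close>, and \<open>f\<close> has been avoided so far.\<close>

lemma rtrancl_first_entry:
  assumes "(a, b) \<in> (hadj E)\<^sup>*"
  shows "(a, b) \<in> (hadj (E - {f}))\<^sup>* \<or> (\<exists>q\<in>f. (a, q) \<in> (hadj (E - {f}))\<^sup>*)"
  using assms
proof (induction rule: rtrancl_induct)
  case (step b c)
  from step.hyps(2) show ?case
    by (rule hadj_step_cases[where f = f]) (use step.IH in \<open>auto intro: rtrancl_into_rtrancl\<close>)
qed simp

text \<open>Here the length of the remaining walk is recorded, for use against minimality in
  \<open>child_exists\<close>. It is strictly smaller because \<open>q\<close> is the end of a step
  through \<open>f\<close>.\<close>

lemma relpow_avoid_or_enter:
  assumes "(z, w) \<in> hadj E ^^ n"
  shows "(z, w) \<in> (hadj (E - {f}))\<^sup>* \<or> (\<exists>q\<in>f. \<exists>m<n. (q, w) \<in> hadj E ^^ m)"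
  using assms
proof (induction n arbitrary: z)
  case (Suc n)
  then obtain b where b: "(z, b) \<in> hadj E" "(b, w) \<in> hadj E ^^ n" by (meson relpow_Suc_D2)
  from b(1) show ?case
  proof (rule hadj_step_cases[where f = f])
    assume "(z, b) \<in> hadj (E - {f})"
    then show ?thesis using Suc.IH[OF b(2)] by (auto intro: converse_rtrancl_into_rtrancl less_SucI)
  qed (use b(2) in blast)
qed simp

lemma hypertree_conn:
  assumes "hypertree G" "y \<in> hverts G" "z \<in> hverts G"
  shows "(y, z) \<in> (hadj (hedges G))\<^sup>*"
proof -
  obtain vs es where "hg_path G y vs es z"
    using assms unfolding hypertree_def hg_connected_def by blast
  then show ?thesis using walk_imp_relpow by (fastforce simp: hg_path_def rtrancl_power)
qed

text \<open>A shortest connection that avoids \<open>f\<close> is a path, and \<open>f\<close>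
  closes it to a cycle. If \<open>y \<noteq> z\<close>, the connection has at least one edge, so the
  cycle has at least two.\<close>

lemma hypertree_edge_separates:
  assumes T: "hypertree G" and f: "f \<in> hedges G" and yz: "y \<in> f" "z \<in> f"
    and conn: "(y, z) \<in> (hadj (hedges G - {f}))\<^sup>*"
  shows "y = z"
proof (rule ccontr)
  assume ne: "y \<noteq> z"
  let ?R = "hadj (hedges G - {f})"
  define n where "n = (LEAST n. (y, z) \<in> ?R ^^ n)"
  have n: "(y, z) \<in> ?R ^^ n"
    using conn unfolding n_def rtrancl_power by (rule LeastI_ex)
  have min: "(y, z) \<notin> ?R ^^ m" if "m < n" for m
    using that not_less_Least unfolding n_def by blast
  have G: "hypergraph G" using T by (simp add: hypertree_def)
  then have yV: "y \<in> hverts G" using f yz by (auto simp: hypergraph_def)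
  obtain vs es where p: "hg_path G y vs es z" "length es = n" "set es \<subseteq> hedges G - {f}"
    using geodesic_walk[OF G yV Diff_subset n min] by metis
  have "vs \<noteq> []" using p(1) by (auto simp: hg_path_def hg_walk_def)
  then have vs: "vs ! 0 = y" "vs ! length es = z" "hd vs = y"
    using p(1) by (auto simp: hg_path_def hg_walk_def hd_conv_nth last_conv_nth)
  have "n \<noteq> 0" using n ne by (cases n) auto
  have "hg_walk G y (vs @ [y]) (es @ [f]) y"
    using p(1) f yz ne vs yV \<open>vs \<noteq> []\<close> unfolding hg_path_def hg_walk_def
    by (auto simp: nth_append less_Suc_eq)
  then have "hg_cycle G (vs @ [y]) (es @ [f])"
    using p \<open>n \<noteq> 0\<close> unfolding hg_cycle_def by (auto simp: hg_path_def)
  then show False using T by (auto simp: hypertree_def)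
qed

lemma hypertree_edges_meet_once:
  assumes "hypertree G" "f \<in> hedges G" "f' \<in> hedges G" "f \<noteq> f'"
    "y \<in> f" "z \<in> f" "y \<in> f'" "z \<in> f'"
  shows "y = z"
  using assms by (intro hypertree_edge_separates[of G f y z] hadj_rtranclI[of f']) auto

section \<open>The parent structure of a hypertree seen from an edge\<close>

locale edge_rooted =
  fixes G :: "'a hypergraph" and e :: "'a set"
  assumes tree: "hypertree G" and e: "e \<in> hedges G"
begin

abbreviation "E \<equiv> hedges G"
abbreviation "V \<equiv> hverts G"

lemma hyper: "hypergraph G" using tree by (simp add: hypertree_def)

lemma edge_sub: "f \<in> E \<Longrightarrow> f \<subseteq> V" and edge_ne: "f \<in> E \<Longrightarrow> f \<noteq> {}"
  using hyper by (auto simp: hypergraph_def)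

lemma finite_V: "finite V" using hyper by (simp add: hypergraph_def)

text \<open>The vertex of \<open>f\<close> closest to \<open>e\<close>, described by connectivity
  instead of distance: from it \<open>e\<close> is reachable without \<open>f\<close>. In this form
  uniqueness is an instance of edge separation.\<close>

definition par :: "'a set \<Rightarrow> 'a" where
  "par f = (THE p. p \<in> f \<and> (\<exists>w\<in>e. (p, w) \<in> (hadj (E - {f}))\<^sup>*))"

lemma par_unique:
  assumes f: "f \<in> E" "f \<noteq> e" and p: "p \<in> f" "w \<in> e" "(p, w) \<in> (hadj (E - {f}))\<^sup>*"
    and q: "q \<in> f" "w' \<in> e" "(q, w') \<in> (hadj (E - {f}))\<^sup>*"
  shows "p = q"
proof -
  have "(w, w') \<in> (hadj (E - {f}))\<^sup>*" using e f p q by (intro hadj_rtranclI[of e]) auto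
  with p(3) hadj_rtrancl_sym[OF q(3)] have "(p, q) \<in> (hadj (E - {f}))\<^sup>*"
    by (meson rtrancl_trans)
  then show ?thesis using hypertree_edge_separates[OF tree f(1)] p q by blast
qed

lemma par:
  assumes f: "f \<in> E" "f \<noteq> e"
  shows "par f \<in> f" "\<exists>w\<in>e. (par f, w) \<in> (hadj (E - {f}))\<^sup>*"
proof -
  obtain y w where y: "y \<in> f" "w \<in> e" using edge_ne f e by blast
  have "(w, y) \<in> (hadj E)\<^sup>*" using y edge_sub f e by (intro hypertree_conn[OF tree]) auto
  from rtrancl_first_entry[OF this, of f] obtain q where "q \<in> f" "(w, q) \<in> (hadj (E - {f}))\<^sup>*"
    using y(1) by blast
  then have "\<exists>q\<in>f. (q, w) \<in> (hadj (E - {f}))\<^sup>*" by (meson hadj_rtrancl_sym)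
  then have "\<exists>!p. p \<in> f \<and> (\<exists>w\<in>e. (p, w) \<in> (hadj (E - {f}))\<^sup>*)"
    using par_unique[OF f] y(2) by metis
  from theI'[OF this] show "par f \<in> f" "\<exists>w\<in>e. (par f, w) \<in> (hadj (E - {f}))\<^sup>*"
    unfolding par_def by auto
qed

lemma par_eqI:
  assumes "f \<in> E" "f \<noteq> e" "p \<in> f" "w \<in> e" "(p, w) \<in> (hadj (E - {f}))\<^sup>*"
  shows "par f = p"
  using par[OF assms(1,2)] par_unique[OF assms] by metis

lemma par_in_e: "f \<in> E \<Longrightarrow> f \<noteq> e \<Longrightarrow> z \<in> f \<Longrightarrow> z \<in> e \<Longrightarrow> par f = z"
  by (rule par_eqI) auto

definition child :: "'a set \<Rightarrow> 'a set" where "child f = f - {par f}"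

text \<open>Let \<open>y\<close> be a child of two edges \<open>f\<close> and \<open>f'\<close>, and
  follow the connection from \<open>par f\<close> to \<open>e\<close>. If it avoids
  \<open>f'\<close>, then \<open>y\<close> reaches \<open>e\<close> through \<open>f\<close> without
  using \<open>f'\<close> and would be the parent of \<open>f'\<close>. If it meets
  \<open>f'\<close>, then \<open>f'\<close> links \<open>par f\<close> to \<open>y\<close> around
  \<open>f\<close>, against separation.\<close>

lemma child_disjoint:
  assumes f: "f \<in> E" "f \<noteq> e" and f': "f' \<in> E" "f' \<noteq> e" and y: "y \<in> child f" "y \<in> child f'"
  shows "f = f'"
proof (rule ccontr)
  assume ne: "f \<noteq> f'"
  have yf: "y \<in> f" "y \<in> f'" "y \<noteq> par f" "y \<noteq> par f'" using y by (auto simp: child_def)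
  obtain w where w: "w \<in> e" "(par f, w) \<in> (hadj (E - {f}))\<^sup>*" using par(2)[OF f] by blast
  from rtrancl_first_entry[OF w(2), of f'] show False
  proof
    assume "(par f, w) \<in> (hadj (E - {f} - {f'}))\<^sup>*"
    then have "(par f, w) \<in> (hadj (E - {f'}))\<^sup>*" by (rule hadj_rtrancl_mono) auto
    moreover have "(y, par f) \<in> (hadj (E - {f'}))\<^sup>*"
      using ne f yf par(1)[OF f] by (intro hadj_rtranclI[of f]) auto
    ultimately have "(y, w) \<in> (hadj (E - {f'}))\<^sup>*" by (meson rtrancl_trans)
    from par_eqI[OF f' yf(2) w(1) this] yf show False by simp
  next
    assume "\<exists>q\<in>f'. (par f, q) \<in> (hadj (E - {f} - {f'}))\<^sup>*"
    then obtain q where q: "q \<in> f'" "(par f, q) \<in> (hadj (E - {f} - {f'}))\<^sup>*" by blast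
    from q(2) have "(par f, q) \<in> (hadj (E - {f}))\<^sup>*" by (rule hadj_rtrancl_mono) auto
    moreover have "(q, y) \<in> (hadj (E - {f}))\<^sup>*"
      using ne f' yf q by (intro hadj_rtranclI[of f']) auto
    ultimately have "(par f, y) \<in> (hadj (E - {f}))\<^sup>*" by (meson rtrancl_trans)
    from hypertree_edge_separates[OF tree f(1) par(1)[OF f] yf(1) this] yf show False by simp
  qed
qed

text \<open>The first edge of a shortest walk from \<open>y\<close> to \<open>e\<close> is the one
  sought. The second vertex of the walk is its parent, because a later use of the same edge could be
  short-circuited from \<open>y\<close>.\<close>

lemma child_exists:
  assumes y: "y \<in> V" "y \<notin> e"
  obtains f where "f \<in> E" "f \<noteq> e" "y \<in> child f"
proof -
  let ?P = "\<lambda>n. \<exists>w\<in>e. (y, w) \<in> hadj E ^^ n"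
  obtain w0 where "w0 \<in> e" using edge_ne e by blast
  then have "\<exists>n. ?P n"
    using hypertree_conn[OF tree y(1), of w0] edge_sub[OF e] by (auto simp: rtrancl_power)
  then obtain n where n: "?P n" "\<And>m. m < n \<Longrightarrow> \<not> ?P m" using exists_least_iff[of ?P] by blast
  then obtain w where w: "w \<in> e" "(y, w) \<in> hadj E ^^ n" by blast
  with y obtain m where m: "n = Suc m" by (cases n) auto
  then obtain z where z: "(y, z) \<in> hadj E" "(z, w) \<in> hadj E ^^ m" using w(2) by (meson relpow_Suc_D2)
  then obtain f where f: "f \<in> E" "y \<in> f" "z \<in> f" "y \<noteq> z" by (auto simp: hadj_def)
  have fe: "f \<noteq> e" using f y by auto
  have "(z, w) \<in> (hadj (E - {f}))\<^sup>*"
  proof (rule ccontr)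
    assume "\<not> ?thesis"
    with relpow_avoid_or_enter[OF z(2), of f] obtain q k where q: "q \<in> f" "k < m" "(q, w) \<in> hadj E ^^ k"
      by blast
    show False
    proof (cases "q = y")
      case True
      then show False using n(2)[of k] q m w(1) by auto
    next
      case False
      then have "(y, q) \<in> hadj E" using f q by (intro hadjI) auto
      then have "(y, w) \<in> hadj E ^^ Suc k" using q(3) by (rule relpow_Suc_I2)
      then show False using n(2)[of "Suc k"] q m w(1) by blast
    qed
  qed
  then have "par f = z" using f fe w by (intro par_eqI) auto
  then have "y \<in> child f" using f by (simp add: child_def)
  then show ?thesis by (rule that[OF f(1) fe])
qed

definition up :: "'a \<Rightarrow> 'a set" where "up y = (THE f. f \<in> E \<and> f \<noteq> e \<and> y \<in> child f)"

lemma up_eqI: "f \<in> E \<Longrightarrow> f \<noteq> e \<Longrightarrow> y \<in> child f \<Longrightarrow> up y = f"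
  unfolding up_def by (rule the_equality) (blast, metis child_disjoint)

lemma up:
  assumes "y \<in> V" "y \<notin> e"
  shows "up y \<in> E" "up y \<noteq> e" "y \<in> child (up y)"
proof -
  obtain f where "f \<in> E" "f \<noteq> e" "y \<in> child f" using child_exists[OF assms] .
  moreover from this have "up y = f" by (rule up_eqI)
  ultimately show "up y \<in> E" "up y \<noteq> e" "y \<in> child (up y)" by simp_all
qed

lemma child_outside: "f \<in> E \<Longrightarrow> f \<noteq> e \<Longrightarrow> y \<in> child f \<Longrightarrow> y \<in> V - e"
  using edge_sub[of f] par_in_e[of f y] by (auto simp: child_def)

text \<open>Deleting the edge \<open>e\<close> leaves one component for each vertex of
  \<open>e\<close>; \<open>root y\<close> names the component of \<open>y\<close>.\<close>

definition root :: "'a \<Rightarrow> 'a" where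
  "root y = (THE w. w \<in> e \<and> (y, w) \<in> (hadj (E - {e}))\<^sup>*)"

lemma root_eqI:
  assumes "w \<in> e" "(y, w) \<in> (hadj (E - {e}))\<^sup>*"
  shows "root y = w"
  unfolding root_def
proof (rule the_equality)
  fix w' assume w': "w' \<in> e \<and> (y, w') \<in> (hadj (E - {e}))\<^sup>*"
  then have "(w', y) \<in> (hadj (E - {e}))\<^sup>*" using hadj_rtrancl_sym by metis
  then have "(w', w) \<in> (hadj (E - {e}))\<^sup>*" using assms(2) by (rule rtrancl_trans)
  then show "w' = w" using hypertree_edge_separates[OF tree e] w' assms(1) by blast
qed (use assms in blast)

lemma root:
  assumes "y \<in> V"
  shows "root y \<in> e" "(y, root y) \<in> (hadj (E - {e}))\<^sup>*"
proof -
  obtain w0 where w0: "w0 \<in> e" using edge_ne e by blast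
  then have "(y, w0) \<in> (hadj E)\<^sup>*"
    using hypertree_conn[OF tree assms, of w0] edge_sub[OF e] by auto
  from rtrancl_first_entry[OF this, of e] obtain w where "w \<in> e" "(y, w) \<in> (hadj (E - {e}))\<^sup>*"
    using w0 by blast
  then show "root y \<in> e" "(y, root y) \<in> (hadj (E - {e}))\<^sup>*" using root_eqI by metis+
qed

lemma root_in_e: "y \<in> e \<Longrightarrow> root y = y"
  by (rule root_eqI) auto

lemma root_edge:
  assumes "f \<in> E" "f \<noteq> e" "y \<in> f" "z \<in> f"
  shows "root y = root z"
proof (rule root_eqI)
  have z: "z \<in> V" using assms edge_sub by blast
  show "root z \<in> e" using root[OF z] by blast
  have "(y, z) \<in> (hadj (E - {e}))\<^sup>*" using assms by (intro hadj_rtranclI[of f]) auto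
  then show "(y, root z) \<in> (hadj (E - {e}))\<^sup>*" using root(2)[OF z] by (meson rtrancl_trans)
qed

text \<open>The distance to \<open>e\<close>, capped at 2.\<close>

definition height :: "'a \<Rightarrow> int" where
  "height y = (if y \<in> e then 0 else if par (up y) \<in> e then 1 else 2)"

lemma height_range: "0 \<le> height y" "height y \<le> 2" "y \<notin> e \<Longrightarrow> 1 \<le> height y"
  by (auto simp: height_def)

lemma height_edge:
  assumes f: "f \<in> E" "f \<noteq> e" and y: "y \<in> f" and z: "z \<in> f"
  shows "height z \<le> height y + 1"
proof (cases "z = par f")
  case True
  then show ?thesis
    using y up_eqI[OF f, of y] child_outside[OF f, of y] height_range[of y] height_range[of z]
    by (cases "y = par f") (auto simp: child_def height_def)
next
  case False
  then have z': "z \<in> child f" using z by (simp add: child_def)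
  then have "up z = f" "z \<notin> e" using up_eqI[OF f] child_outside[OF f] by auto
  then show ?thesis
    using y up_eqI[OF f, of y] child_outside[OF f, of y] height_range[of y]
    by (cases "y = par f") (auto simp: child_def height_def)
qed

text \<open>The potential is minus the height on the branch of \<open>y\<close> and one plus the
  height on all other branches. Inside a branch the height changes by at most 1 along an edge,
  capped or not; branches are joined only by \<open>e\<close>, where the potential goes from 0 to
  1.\<close>

lemma hg_distance_different_roots:
  assumes y: "y \<in> V" and z: "z \<in> V" and ne: "root y \<noteq> root z"
  shows "int (hg_distance G y z) \<ge> 1 + height y + height z"
proof -
  define \<phi> where "\<phi> = (\<lambda>t. if root t = root y then - height t else 1 + height t)"
  have "\<phi> b \<le> \<phi> a + 1" if ab: "(a, b) \<in> hadj E" for a b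
  proof -
    obtain f where f: "f \<in> E" "a \<in> f" "b \<in> f" using ab by (auto simp: hadj_def)
    show ?thesis
    proof (cases "f = e")
      case True
      then show ?thesis using f by (auto simp: \<phi>_def height_def)
    next
      case False
      then show ?thesis
        using root_edge[OF f(1) False f(2,3)] height_edge[OF f(1) False f(2,3)]
          height_edge[OF f(1) False f(3,2)] by (auto simp: \<phi>_def)
    qed
  qed
  then have "\<phi> z \<le> \<phi> y + int (hg_distance G y z)"
    by (rule relpow_potential[OF relpow_hg_distance[OF hyper y hypertree_conn[OF tree y z]]])
  then show ?thesis using ne by (auto simp: \<phi>_def)
qed

lemma hg_distance_ge_1:
  assumes "y \<in> V" "z \<in> V" "y \<noteq> z"
  shows "hg_distance G y z \<ge> 1"
  using relpow_hg_distance[OF hyper assms(1) hypertree_conn[OF tree assms(1,2)]] assms(3)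
  by (cases "hg_distance G y z") auto

lemma hg_distance_ge_2:
  assumes "y \<in> V" "z \<in> V" "y \<noteq> z" "(y, z) \<notin> hadj E"
  shows "hg_distance G y z \<ge> 2"
proof -
  have "hg_distance G y z \<noteq> 1"
    using relpow_hg_distance[OF hyper assms(1) hypertree_conn[OF tree assms(1,2)]] assms(4) by auto
  then show ?thesis using hg_distance_ge_1[OF assms(1-3)] by linarith
qed

lemma hadj_cases:
  assumes "(y, z) \<in> hadj E" "y \<notin> e \<or> z \<notin> e"
  obtains "y \<notin> e" "z \<notin> e" "up y = up z" | "y \<notin> e" "z = par (up y)" | "z \<notin> e" "y = par (up z)"
proof -
  obtain f where f: "f \<in> E" "y \<in> f" "z \<in> f" "y \<noteq> z" using assms(1) by (auto simp: hadj_def)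
  have fe: "f \<noteq> e" using f assms(2) by auto
  have *: "up t = f \<and> t \<notin> e" if "t \<in> f" "t \<noteq> par f" for t
    using that up_eqI[OF f(1) fe, of t] child_outside[OF f(1) fe, of t] by (auto simp: child_def)
  show ?thesis
    using that *[of y] *[of z] f by metis
qed

end

section \<open>The comparison hypertree\<close>

text \<open>The eigenvalue equations of \<open>D\<close> for the values \<open>\<alpha>\<close> on
  \<open>P\<close>, \<open>\<beta>\<close> at \<open>u\<close>, \<open>\<gamma>\<close> on
  \<open>e - {u, v}\<close>, \<open>\<delta>\<close> at \<open>v\<close> and
  \<open>\<epsilon>\<close> on \<open>B\<close>, with \<open>c = k - 1\<close> and
  \<open>M = card B\<close>. \<open>R\<close> is the spectral radius plus 1: the shift adds the
  vertex's own value to its row, so that a set of mutually adjacent vertices enters with its full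
  sum. The term \<open>- c * \<epsilon>\<close> corrects distance 2 to distance 1 inside a petal at
  \<open>v\<close>.\<close>

locale double_star_system =
  fixes R c M \<alpha> \<beta> \<gamma> \<delta> \<epsilon> :: real
  assumes pos: "\<alpha> > 0" "\<beta> > 0" "\<gamma> > 0" "\<delta> > 0" "\<epsilon> > 0" and c: "c \<ge> 1" and M: "M \<ge> c"
    and eq_\<alpha>: "R * \<alpha> = c * \<alpha> + \<beta> + 2 * ((c - 1) * \<gamma>) + 2 * \<delta> + 3 * (M * \<epsilon>)"
    and eq_\<beta>: "R * \<beta> = c * \<alpha> + \<beta> + (c - 1) * \<gamma> + \<delta> + 2 * (M * \<epsilon>)"
    and eq_\<gamma>: "R * \<gamma> = 2 * (c * \<alpha>) + \<beta> + (c - 1) * \<gamma> + \<delta> + 2 * (M * \<epsilon>)"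
    and eq_\<delta>: "R * \<delta> = 2 * (c * \<alpha>) + \<beta> + (c - 1) * \<gamma> + \<delta> + M * \<epsilon>"
    and eq_\<epsilon>: "R * \<epsilon> = 3 * (c * \<alpha>) + 2 * \<beta> + 2 * ((c - 1) * \<gamma>) + \<delta> + 2 * (M * \<epsilon>) - c * \<epsilon>"
begin

lemma W_nonneg: "(c - 1) * \<gamma> \<ge> 0" using c pos by simp

lemma c_\<alpha>: "c * \<alpha> \<ge> \<alpha>" using c pos by simp

lemma R_gt: "R > 2 * M - c"
proof -
  have "(R - (2 * M - c)) * \<epsilon> = 3 * (c * \<alpha>) + 2 * \<beta> + 2 * ((c - 1) * \<gamma>) + \<delta>"
    using eq_\<epsilon> by (simp add: algebra_simps)
  then have "(R - (2 * M - c)) * \<epsilon> > 0" using W_nonneg c_\<alpha> pos by linarith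
  then show ?thesis using pos by (simp add: zero_less_mult_iff)
qed

lemma R_ge: "R > M" "R > 1" using R_gt M c by linarith+

lemma t_eq: "R * (\<beta> - \<delta>) = M * \<epsilon> - c * \<alpha>"
  using eq_\<beta> eq_\<delta> by (simp add: algebra_simps)

text \<open>Pays for a parent in \<open>B\<close> outside the branch at \<open>u\<close>. If
  \<open>\<beta> \<ge> \<delta>\<close>, comparing the equations for \<open>\<epsilon>\<close> and
  \<open>\<delta>\<close> gives \<open>\<epsilon> < 2 * \<delta>\<close>; otherwise the sign of
  \<open>\<beta> - \<delta>\<close> forces \<open>\<epsilon> < \<alpha>\<close>.\<close>

lemma \<epsilon>_bound: "\<epsilon> < \<delta> + \<beta> + c * \<alpha>"
proof (cases "\<beta> \<ge> \<delta>")
  case True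
  have "(R + c) * \<epsilon> = 2 * (R * \<delta>) - c * \<alpha> - \<delta>"
    using eq_\<epsilon> eq_\<delta> by (simp add: algebra_simps)
  moreover have "R * \<delta> \<le> (R + c) * \<delta>" using c pos by simp
  moreover have "(R + c) * (2 * \<delta>) = 2 * ((R + c) * \<delta>)" by simp
  ultimately have "(R + c) * \<epsilon> < (R + c) * (2 * \<delta>)" using pos c_\<alpha> by linarith
  then have "\<epsilon> < 2 * \<delta>" using R_ge c by (simp add: mult_less_cancel_left)
  then show ?thesis using True pos c_\<alpha> by linarith
next
  case False
  then have "R * (\<beta> - \<delta>) < 0" using R_ge by (simp add: mult_pos_neg)
  moreover have "c * \<epsilon> \<le> M * \<epsilon>" using M pos by simp
  ultimately have "c * \<epsilon> < c * \<alpha>" using t_eq by linarith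
  then have "\<epsilon> < \<alpha>" using c by simp
  then show ?thesis using pos c_\<alpha> by linarith
qed

text \<open>Pays for a parent in \<open>e\<close> other than \<open>u\<close> and \<open>v\<close>.
  The equations for \<open>\<gamma>\<close> and \<open>\<delta>\<close> differ only in the distance
  to \<open>B\<close>.\<close>

lemma \<gamma>_bound: "\<gamma> < \<delta> + c * \<epsilon>"
proof -
  have "R * (\<gamma> - \<delta>) = M * \<epsilon>" using eq_\<gamma> eq_\<delta> by (simp add: algebra_simps)
  also have "\<dots> < R * \<epsilon>" using R_ge pos by simp
  finally have "\<gamma> - \<delta> < \<epsilon>" using R_ge by simp
  moreover have "\<epsilon> \<le> c * \<epsilon>" using c pos by simp
  ultimately show ?thesis by linarith
qed

text \<open>Pays for the branch at \<open>u\<close>, where a moved vertex loses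
  \<open>c * \<alpha>\<close> by getting farther from \<open>P\<close>. The size of \<open>M\<close>
  rules out \<open>\<alpha> < \<epsilon>\<close>; from \<open>\<alpha> \<ge> \<epsilon>\<close> the
  equation for \<open>\<epsilon>\<close> sharpens the bound on \<open>R\<close> to
  \<open>R > 2 * M + 2 * c\<close>, which leaves enough room for the claim.\<close>

lemma \<beta>_bound:
  assumes M3: "M \<ge> 3 * c"
  shows "\<beta> + c * \<alpha> < \<delta> + 2 * (c * \<epsilon>)"
proof -
  define t where "t = \<beta> - \<delta>"
  have t: "R * t = M * \<epsilon> - c * \<alpha>" using t_eq by (simp add: t_def)
  have \<alpha>\<epsilon>: "(R + 2 * c) * (\<alpha> - \<epsilon>) = (M - c) * \<epsilon> - t"
    using eq_\<alpha> eq_\<epsilon> by (simp add: t_def algebra_simps)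
  have "\<alpha> \<ge> \<epsilon>"
  proof (rule ccontr)
    assume "\<not> \<alpha> \<ge> \<epsilon>"
    then have "(R + 2 * c) * (\<alpha> - \<epsilon>) < 0" using R_ge c by (intro mult_pos_neg) auto
    then have "t > (M - c) * \<epsilon>" using \<alpha>\<epsilon> by linarith
    then have "R * t > R * ((M - c) * \<epsilon>)" using R_ge by simp
    moreover have "R * t < M * \<epsilon>" using t c_\<alpha> pos by linarith
    ultimately have "(R * (M - c)) * \<epsilon> < M * \<epsilon>" by (simp add: mult.assoc)
    then have 1: "R * (M - c) < M" using pos by simp
    have "M \<le> 2 * (M - c)" using M3 c by (simp add: algebra_simps)
    also have "\<dots> \<le> R * (M - c)" using R_gt M3 c by (intro mult_right_mono) linarith+
    finally show False using 1 by linarith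
  qed
  then have \<alpha>: "c * \<epsilon> \<le> c * \<alpha>" using c by simp
  have "(R - (2 * M + 2 * c)) * \<epsilon> = 3 * (c * \<alpha>) - 3 * (c * \<epsilon>) + 2 * \<beta> + 2 * ((c - 1) * \<gamma>) + \<delta>"
    using eq_\<epsilon> by (simp add: algebra_simps)
  then have "(R - (2 * M + 2 * c)) * \<epsilon> > 0" using \<alpha> W_nonneg pos by linarith
  then have R: "R > 2 * M + 2 * c" using pos by (simp add: zero_less_mult_iff)
  have t_le: "R * t \<le> (M - c) * \<epsilon>" using t \<alpha> by (simp add: algebra_simps)
  have ct: "c * t \<le> c * \<epsilon>"
  proof -
    have "(M - c) * \<epsilon> \<le> R * \<epsilon>" using R M3 c pos by (intro mult_right_mono) linarith+
    with t_le have "R * t \<le> R * \<epsilon>" by linarith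
    then show ?thesis using R_ge c by simp
  qed
  \<comment> \<open>The claim is positivity of the second factor. With \<open>R + 2 * c\<close> in
    front, the identity for \<open>\<alpha> - \<epsilon>\<close> eliminates \<open>\<alpha>\<close>
    in favour of \<open>\<epsilon>\<close> and \<open>t\<close>.\<close>
  have "(R + 2 * c) * (c * (2 * \<epsilon> - \<alpha>) - t) = c * (R + 3 * c - M) * \<epsilon> - R * t - c * t"
  proof -
    have "(R + 2 * c) * (c * (2 * \<epsilon> - \<alpha>) - t)
      = c * ((R + 2 * c) * \<epsilon> - (R + 2 * c) * (\<alpha> - \<epsilon>)) - (R + 2 * c) * t"
      by (simp add: algebra_simps)
    then show ?thesis unfolding \<alpha>\<epsilon> by (simp add: algebra_simps)
  qed
  moreover have "c * (R + 3 * c - M) * \<epsilon> \<ge> (M + 5 * c) * \<epsilon>"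
  proof -
    have "M + 5 * c \<le> R + 3 * c - M" using R by linarith
    also have "\<dots> \<le> c * (R + 3 * c - M)" using R M3 c by (intro mult_le_cancel_right1[THEN iffD2]) auto
    finally show ?thesis using pos by (intro mult_right_mono) auto
  qed
  moreover have "(M + 5 * c) * \<epsilon> > (M - c) * \<epsilon> + c * \<epsilon>" using c pos by (simp add: algebra_simps)
  ultimately have "(R + 2 * c) * (c * (2 * \<epsilon> - \<alpha>) - t) > 0" using t_le ct by linarith
  then have "c * (2 * \<epsilon> - \<alpha>) - t > 0" using R_ge c by (simp add: zero_less_mult_iff)
  then show ?thesis by (simp add: t_def algebra_simps)
qed

end

section \<open>Moving the edges to \<open>v\<close>, and the distances that result\<close>

locale branching = edge_rooted +
  fixes k :: nat and u v :: 'a and g :: "'a set"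
  assumes k: "k \<ge> 2" and uniform: "k_uniform k G"
    and u: "u \<in> e" and v: "v \<in> e" and uv: "u \<noteq> v"
    and g: "g \<in> E" "g \<noteq> e" "u \<in> g"
    and v_branch: "\<exists>f\<in>E. f \<noteq> e \<and> v \<in> f"
    and v_heavier: "card {y \<in> V - e. root y = u} \<le> card {y \<in> V - e. root y = v}"
begin

definition P :: "'a set" where "P = child g"
definition B :: "'a set" where "B = V - e - P"
definition F :: "'a set set" where "F = E - {e, g}"
definition D :: "'a hypergraph" where
  "D = Hypergraph V (insert e (insert g ((\<lambda>f. insert v (child f)) ` F)))"

lemma card_edge: "f \<in> E \<Longrightarrow> card f = k"
  using uniform by (simp add: k_uniform_def)

lemma finite_edge: "f \<in> E \<Longrightarrow> finite f"
  using edge_sub finite_V finite_subset by blast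

lemma card_child: "f \<in> E \<Longrightarrow> f \<noteq> e \<Longrightarrow> card (child f) = k - 1"
  using par(1)[of f] card_edge[of f] finite_edge[of f] by (simp add: child_def)

lemma par_g: "par g = u" using par_in_e[OF g(1,2,3) u] .

lemma P_eq: "P = g - {u}" by (simp add: P_def child_def par_g)

lemma P_outside: "P \<subseteq> V - e"
  using child_outside[OF g(1,2)] by (auto simp: P_def)

lemma up_P: "y \<in> P \<Longrightarrow> up y = g"
  using up_eqI[OF g(1,2)] by (simp add: P_def)

lemma root_P: "y \<in> P \<Longrightarrow> root y = u"
  using root_edge[OF g(1,2), of y u] g(3) root_in_e[OF u] by (simp add: P_eq)

lemma height_P: "y \<in> P \<Longrightarrow> height y = 1"
  using P_outside up_P par_g u by (auto simp: height_def)

lemma child_F: "f \<in> F \<Longrightarrow> y \<in> child f \<longleftrightarrow> y \<in> B \<and> up y = f"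
proof
  assume f: "f \<in> F" and y: "y \<in> child f"
  then have "up y = f" by (intro up_eqI) (auto simp: F_def)
  moreover from this have "y \<notin> P" using f up_P by (auto simp: F_def)
  ultimately show "y \<in> B \<and> up y = f"
    using f y child_outside[of f y] by (auto simp: B_def F_def)
next
  assume "f \<in> F" "y \<in> B \<and> up y = f"
  then show "y \<in> child f" using up(3)[of y] by (auto simp: B_def)
qed

lemma B_up: "y \<in> B \<Longrightarrow> up y \<in> F"
proof -
  assume y: "y \<in> B"
  then have "y \<in> V" "y \<notin> e" "y \<notin> P" by (auto simp: B_def)
  with up[of y] show "up y \<in> F" by (auto simp: F_def P_def)
qed

lemma B_sub: "B \<subseteq> V" by (auto simp: B_def)

lemma v_notin: "v \<notin> P" "v \<notin> B" "u \<notin> P" "u \<notin> B" and uvV: "u \<in> V" "v \<in> V"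
  using P_outside v u edge_sub[OF e] by (auto simp: B_def)

lemma D_edges: "f \<in> hedges D \<longleftrightarrow> f = e \<or> f = g \<or> (\<exists>f'\<in>F. f = insert v (child f'))"
  by (auto simp: D_def)

lemma hverts_D [simp]: "hverts D = V" by (simp add: D_def)

lemma hypergraph_D: "hypergraph D"
proof -
  have "insert v (child f) \<subseteq> V" if "f \<in> F" for f
    using child_outside[of f] that uvV by (auto simp: F_def)
  then have "f \<noteq> {} \<and> f \<subseteq> V" if "f \<in> hedges D" for f
    using that edge_sub[OF e] edge_sub[OF g(1)] edge_ne[OF e] edge_ne[OF g(1)]
    unfolding D_edges by auto
  then show ?thesis
    using finite_V uvV by (auto simp: hypergraph_def)
qed

lemma hadj_D:
  "(y, z) \<in> hadj (hedges D) \<longleftrightarrow> y \<noteq> z \<and> (y \<in> e \<and> z \<in> e \<or> y \<in> g \<and> z \<in> g \<or>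
     y = v \<and> z \<in> B \<or> z = v \<and> y \<in> B \<or> y \<in> B \<and> z \<in> B \<and> up y = up z)"
proof -
  have "(\<exists>f\<in>F. y \<in> insert v (child f) \<and> z \<in> insert v (child f)) \<longleftrightarrow>
      y = v \<and> z \<in> B \<or> z = v \<and> y \<in> B \<or> y \<in> B \<and> z \<in> B \<and> up y = up z" if "y \<noteq> z"
    using that child_F B_up v_notin by auto
  note star = this
  show ?thesis
  proof (cases "y = z")
    case False
    then have "(y, z) \<in> hadj (hedges D) \<longleftrightarrow> y \<in> e \<and> z \<in> e \<or> y \<in> g \<and> z \<in> g \<or>
        (\<exists>f\<in>F. y \<in> insert v (child f) \<and> z \<in> insert v (child f))"
      by (simp only: hadj_def D_def hypergraph.sel mem_Collect_eq prod.case bex_simps simp_thms)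
    then show ?thesis using False unfolding star[OF False] by blast
  qed (simp add: hadj_def)
qed

text \<open>Distances in a double star: \<open>P\<close> is the only petal at \<open>u\<close>,
  \<open>B\<close> is the union of the petals at \<open>v\<close>, and distance 3 occurs exactly
  between the two.\<close>

definition dD :: "'a \<Rightarrow> 'a \<Rightarrow> nat" where
  "dD y z = (if y = z then 0
     else if y \<in> B then
       (if z \<in> B then (if up y = up z then 1 else 2) else if z = v then 1 else if z \<in> P then 3 else 2)
     else if z \<in> B then (if y = v then 1 else if y \<in> P then 3 else 2)
     else if y \<in> e \<and> z \<in> e \<or> y \<in> g \<and> z \<in> g then 1 else 2)"

lemma V_cases:
  assumes "y \<in> V"
  shows "y \<in> P \<and> y \<notin> e \<and> y \<notin> B \<and> y \<in> g \<or> y \<in> e \<and> y \<notin> P \<and> y \<notin> B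
    \<or> y \<in> B \<and> y \<notin> e \<and> y \<notin> P \<and> y \<notin> g"
  using assms P_outside u unfolding B_def P_eq by blast

text \<open>That \<open>P\<close> and \<open>B\<close> are at distance at least 3 follows from a
  potential with values 0 on \<open>P\<close>, 1 at \<open>u\<close>, 2 on the rest of
  \<open>e\<close> and 3 on \<open>B\<close>. Any other pair of distinct nonadjacent vertices has a
  common neighbour: \<open>v\<close> if the pair meets \<open>B\<close>, and \<open>u\<close> if it
  does not.\<close>

lemma hg_distance_D:
  assumes y: "y \<in> V" and z: "z \<in> V"
  shows "hg_distance D y z = dD y z"
proof -
  let ?R = "hadj (hedges D)"
  have two: "(a, b) \<in> ?R ^^ 2" if "(a, t) \<in> ?R" "(t, b) \<in> ?R" for a b t
    using that by (auto simp: numeral_2_eq_2)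
  have three: "(a, b) \<in> ?R ^^ 3 \<and> (\<forall>m<3. (a, b) \<notin> ?R ^^ m)" if a: "a \<in> P" and b: "b \<in> B" for a b
  proof (intro conjI allI impI notI)
    have "(a, u) \<in> ?R" "(u, v) \<in> ?R" "(v, b) \<in> ?R"
      unfolding hadj_D using a b u v uv g(3) v_notin by (auto simp: P_eq)
    then show "(a, b) \<in> ?R ^^ 3" by (auto simp: numeral_3_eq_3)
    fix m assume m: "m < (3::nat)" "(a, b) \<in> ?R ^^ m"
    define \<phi> :: "'a \<Rightarrow> int" where
      "\<phi> = (\<lambda>t. if t \<in> P then 0 else if t = u then 1 else if t \<in> e then 2 else 3)"
    have "\<phi> b \<le> \<phi> a + int m"
    proof (rule relpow_potential[OF m(2)])
      fix s t assume "(s, t) \<in> ?R"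
      then show "\<phi> t \<le> \<phi> s + 1"
        unfolding hadj_D \<phi>_def using u v uv v_notin P_outside by (auto simp: P_eq B_def)
    qed
    moreover have "\<phi> a = 0" "\<phi> b = 3" using a b u by (auto simp: \<phi>_def B_def)
    ultimately show False using m(1) by simp
  qed
  have "(y, z) \<in> ?R ^^ dD y z \<and> (\<forall>m<dD y z. (y, z) \<notin> ?R ^^ m)"
  proof -
    consider (0) "y = z" | (1) "(y, z) \<in> ?R" | (a) "y \<in> P" "z \<in> B" | (b) "y \<in> B" "z \<in> P"
      | (2) "y \<noteq> z" "(y, z) \<notin> ?R" "\<not> (y \<in> P \<and> z \<in> B)" "\<not> (y \<in> B \<and> z \<in> P)" by blast
    then show ?thesis
    proof cases
      case 0
      then show ?thesis by (simp add: dD_def)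
    next
      case 1
      then have "dD y z = 1" "y \<noteq> z"
        unfolding hadj_D dD_def using v_notin v uv V_cases[OF y] V_cases[OF z] by auto
      then show ?thesis using 1 by auto
    next
      case a
      then have "dD y z = 3" using v_notin by (auto simp: dD_def B_def)
      then show ?thesis using three[OF a] by simp
    next
      case b
      then have "dD y z = 3" using v_notin by (auto simp: dD_def B_def)
      moreover have "(y, z) \<in> ?R ^^ m \<longleftrightarrow> (z, y) \<in> ?R ^^ m" for m
        by (auto intro: sym_relpow[OF sym_hadj])
      ultimately show ?thesis using three[OF b(2,1)] by simp
    next
      case 2
      have "dD y z = 2"
        using 2 V_cases[OF y] V_cases[OF z] unfolding hadj_D dD_def by auto
      moreover have "(y, z) \<in> ?R ^^ 2"
      proof (cases "y \<in> B \<or> z \<in> B")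
        case True
        have "(t, v) \<in> ?R" if "t = y \<or> t = z" for t
          using True that 2 v v_notin V_cases[OF y] V_cases[OF z] unfolding hadj_D by auto
        then have "(y, v) \<in> ?R" "(z, v) \<in> ?R" by blast+
        then have "(y, v) \<in> ?R" "(v, z) \<in> ?R" using symD[OF sym_hadj, of z v] by blast+
        then show ?thesis by (rule two)
      next
        case False
        have "(t, u) \<in> ?R" if "t = y \<or> t = z" for t
          using False that 2 u g(3) v_notin V_cases[OF y] V_cases[OF z] unfolding hadj_D by auto
        then have "(y, u) \<in> ?R" "(z, u) \<in> ?R" by blast+
        then have "(y, u) \<in> ?R" "(u, z) \<in> ?R" using symD[OF sym_hadj, of z u] by blast+
        then show ?thesis by (rule two)
      qed
      ultimately show ?thesis using 2 by (auto simp: less_2_cases_iff)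
    qed
  qed
  then show ?thesis
    unfolding hg_distance_eq[OF hypergraph_D, unfolded hverts_D, OF y]
    by (intro Least_equality) (auto intro: leI)
qed

lemma dD_sym: "dD y z = dD z y"
  by (auto simp: dD_def)

end

section \<open>The Perron vector of the comparison hypertree\<close>

context branching
begin

definition Wd :: "'a set" where "Wd = e - {u, v}"

lemma finite_parts: "finite P" "finite B" "finite Wd" "finite e"
  using finite_V P_outside finite_edge[OF e] by (auto simp: B_def Wd_def intro: finite_subset)

lemma Wd_cases: "w \<in> Wd \<Longrightarrow> w \<in> e \<and> w \<noteq> u \<and> w \<noteq> v \<and> w \<notin> P \<and> w \<notin> B \<and> w \<notin> g \<and> w \<in> V"
  using P_outside edge_sub[OF e] unfolding Wd_def B_def P_eq by blast

lemma e_eq: "e = insert u (insert v Wd)"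
  using u v by (auto simp: Wd_def)

lemma V_eq: "V = P \<union> (e \<union> B)"
  using P_outside edge_sub[OF e] by (auto simp: B_def)

lemma sum_V: "sum h V = sum h P + h u + sum h Wd + h v + sum h B" for h :: "'a \<Rightarrow> real"
proof -
  have "V = P \<union> (insert u (insert v Wd) \<union> B)" using V_eq e_eq by simp
  moreover have "P \<inter> (insert u (insert v Wd) \<union> B) = {}" "insert u (insert v Wd) \<inter> B = {}"
    using v_notin Wd_cases by (auto simp: B_def)
  moreover have "u \<notin> insert v Wd" "v \<notin> Wd" using uv by (auto simp: Wd_def)
  ultimately show ?thesis using finite_parts by (simp add: sum.union_disjoint)
qed

abbreviation "c \<equiv> real (k - 1)"
abbreviation "M \<equiv> real (card B)"

lemma card_parts: "card P = k - 1" "real (card Wd) = c - 1"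
proof -
  show "card P = k - 1" using card_child[OF g(1,2)] by (simp add: P_def)
  have "card Wd = k - 2" using card_edge[OF e] u v uv finite_parts by (simp add: Wd_def)
  then show "real (card Wd) = c - 1" using k by simp
qed

lemma child_sub_B: "f \<in> F \<Longrightarrow> child f \<subseteq> B"
  using child_F by blast

lemma card_child_F: "f \<in> F \<Longrightarrow> card (child f) = k - 1"
  using card_child by (simp add: F_def)

definition branch :: "'a \<Rightarrow> 'a set" where "branch w = {y \<in> V - e. root y = w}"

lemma branch_v_sub: "branch v \<subseteq> B"
  using root_P uv by (auto simp: branch_def B_def)

lemma card_branch_v: "card (branch v) \<ge> k - 1"
proof -
  obtain f where f: "f \<in> E" "f \<noteq> e" "v \<in> f" using v_branch by blast
  have "child f \<subseteq> branch v"
    using child_outside[OF f(1,2)] root_edge[OF f(1,2) _ f(3)] root_in_e[OF v]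
    by (auto simp: branch_def child_def)
  then show ?thesis
    using card_child[OF f(1,2)] card_mono[of "branch v" "child f"] finite_V by (simp add: branch_def)
qed

lemma M_ge_c: "M \<ge> c"
  using card_branch_v card_mono[OF finite_parts(2) branch_v_sub] by simp

text \<open>A moved edge in the branch at \<open>u\<close> has \<open>k - 1\<close> children there
  in addition to the \<open>k - 1\<close> vertices of \<open>P\<close>. By \<open>v_heavier\<close>
  the branch at \<open>v\<close> is at least as large, and \<open>B\<close> contains that branch
  together with the children of the moved edge.\<close>

lemma two_branches:
  assumes y: "y \<in> B" "root y = u"
  shows "real (card (branch v)) \<ge> 2 * c" "M \<ge> 3 * c"
proof -
  let ?f = "up y"
  have f: "?f \<in> F" "?f \<in> E" "?f \<noteq> e" using B_up[OF y(1)] by (auto simp: F_def)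
  have yf: "y \<in> child ?f" using child_F[OF f(1)] y by blast
  have root_f: "root z = u" if "z \<in> child ?f" for z
    using root_edge[OF f(2,3), of z y] that yf y(2) by (simp add: child_def)
  have "P \<union> child ?f \<subseteq> branch u"
    using P_outside root_P root_f child_outside[OF f(2,3)] by (auto simp: branch_def)
  moreover have "P \<inter> child ?f = {}" using child_sub_B[OF f(1)] by (auto simp: B_def)
  moreover have "finite (child ?f)" using child_sub_B[OF f(1)] finite_parts(2) finite_subset by blast
  ultimately have "card P + card (child ?f) \<le> card (branch u)"
    using finite_parts finite_V card_mono[of "branch u" "P \<union> child ?f"]
    by (simp add: branch_def card_Un_disjoint)
  then have "2 * (k - 1) \<le> card (branch v)"
    using v_heavier card_parts card_child_F[OF f(1)] by (simp add: branch_def)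
  then show 1: "real (card (branch v)) \<ge> 2 * c" by linarith
  have "branch v \<inter> child ?f = {}" using root_f uv by (auto simp: branch_def)
  moreover have "branch v \<union> child ?f \<subseteq> B" using branch_v_sub child_sub_B[OF f(1)] by blast
  moreover have "finite (branch v)" using finite_V by (simp add: branch_def)
  ultimately have "card (branch v) + card (child ?f) \<le> card B"
    using \<open>finite (child ?f)\<close> finite_parts card_mono[of B "branch v \<union> child ?f"]
    by (simp add: card_Un_disjoint)
  then show "M \<ge> 3 * c" using 1 card_child_F[OF f(1)] by simp
qed

text \<open>The terms \<open>- x w\<close> come from the zero diagonal and are absorbed when 1 is
  added to the eigenvalue. What is left is the same for all \<open>w\<close> of a class, except that
  on \<open>B\<close> the petal of \<open>w\<close> still occurs.\<close>

lemma row_sums: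
  fixes x :: "'a \<Rightarrow> real"
  defines "rsum \<equiv> \<lambda>w. \<Sum>z\<in>V. real (dD w z) * x z"
  shows "w \<in> P \<Longrightarrow> rsum w = sum x P - x w + x u + 2 * sum x Wd + 2 * x v + 3 * sum x B"
    and "rsum u = sum x P + sum x Wd + x v + 2 * sum x B"
    and "w \<in> Wd \<Longrightarrow> rsum w = 2 * sum x P + x u + sum x Wd - x w + x v + 2 * sum x B"
    and "rsum v = 2 * sum x P + x u + sum x Wd + sum x B"
    and "w \<in> B \<Longrightarrow> rsum w = 3 * sum x P + 2 * x u + 2 * sum x Wd + x v + 2 * sum x B
      - sum x (child (up w)) - x w"
proof -
  have coeff: "(\<Sum>z\<in>A. real (dD w z) * x z) = t * sum x A" if "\<And>z. z \<in> A \<Longrightarrow> real (dD w z) = t" for w t A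
    using that by (simp add: sum_distrib_left)
  have coeff1: "(\<Sum>z\<in>A. real (dD w z) * x z) = sum x A - x w"
    if "finite A" "w \<in> A" "\<And>z. z \<in> A \<Longrightarrow> z \<noteq> w \<Longrightarrow> dD w z = 1" for w A
  proof -
    have "(\<Sum>z\<in>A. real (dD w z) * x z) = (\<Sum>z\<in>A. x z - (if z = w then x w else 0))"
      using that(3) by (intro sum.cong) (auto simp: dD_def)
    then show ?thesis using that(1,2) by (simp add: sum_subtractf)
  qed
  have PD: "z \<in> V" "z \<in> g" "z \<notin> e" "z \<notin> B" "z \<noteq> u" "z \<noteq> v" if "z \<in> P" for z
    using that P_outside v_notin by (auto simp: B_def P_eq)
  have BD: "z \<notin> e" "z \<notin> P" "z \<noteq> u" "z \<noteq> v" "z \<notin> g" if "z \<in> B" for z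
    using that v_notin V_cases[of z] B_sub by blast+
  have vg: "v \<notin> g" using v_notin uv by (simp add: P_eq)
  show "rsum w = sum x P - x w + x u + 2 * sum x Wd + 2 * x v + 3 * sum x B" if w: "w \<in> P"
  proof -
    have "(\<Sum>z\<in>P. real (dD w z) * x z) = sum x P - x w"
      using w PD finite_parts by (intro coeff1) (auto simp: dD_def)
    moreover have "(\<Sum>z\<in>Wd. real (dD w z) * x z) = 2 * sum x Wd"
      using w PD[OF w] Wd_cases by (intro coeff) (auto simp: dD_def)
    moreover have "(\<Sum>z\<in>B. real (dD w z) * x z) = 3 * sum x B"
      using w PD[OF w] BD by (intro coeff) (auto simp: dD_def)
    moreover have "dD w u = 1" "dD w v = 2"
      using PD[OF w] v_notin g(3) vg by (auto simp: dD_def)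
    ultimately show ?thesis unfolding rsum_def sum_V by simp
  qed
  show "rsum u = sum x P + sum x Wd + x v + 2 * sum x B"
  proof -
    have "(\<Sum>z\<in>P. real (dD u z) * x z) = 1 * sum x P"
      using PD g(3) v_notin by (intro coeff) (auto simp: dD_def)
    moreover have "(\<Sum>z\<in>Wd. real (dD u z) * x z) = 1 * sum x Wd"
      using u v_notin Wd_cases by (intro coeff) (auto simp: dD_def)
    moreover have "(\<Sum>z\<in>B. real (dD u z) * x z) = 2 * sum x B"
      using v_notin uv BD by (intro coeff) (auto simp: dD_def)
    moreover have "dD u u = 0" "dD u v = 1" using u v uv v_notin by (auto simp: dD_def)
    ultimately show ?thesis unfolding rsum_def sum_V by simp
  qed
  show "rsum w = 2 * sum x P + x u + sum x Wd - x w + x v + 2 * sum x B" if w: "w \<in> Wd"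
  proof -
    have "(\<Sum>z\<in>P. real (dD w z) * x z) = 2 * sum x P"
      using PD Wd_cases[OF w] by (intro coeff) (auto simp: dD_def)
    moreover have "(\<Sum>z\<in>Wd. real (dD w z) * x z) = sum x Wd - x w"
      using w Wd_cases finite_parts by (intro coeff1) (auto simp: dD_def)
    moreover have "(\<Sum>z\<in>B. real (dD w z) * x z) = 2 * sum x B"
      using Wd_cases[OF w] BD by (intro coeff) (auto simp: dD_def)
    moreover have "dD w u = 1" "dD w v = 1" using u v Wd_cases[OF w] v_notin by (auto simp: dD_def)
    ultimately show ?thesis unfolding rsum_def sum_V by simp
  qed
  show "rsum v = 2 * sum x P + x u + sum x Wd + sum x B"
  proof -
    have "(\<Sum>z\<in>P. real (dD v z) * x z) = 2 * sum x P"
      using PD vg v_notin by (intro coeff) (auto simp: dD_def)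
    moreover have "(\<Sum>z\<in>Wd. real (dD v z) * x z) = 1 * sum x Wd"
      using v v_notin Wd_cases by (intro coeff) (auto simp: dD_def)
    moreover have "(\<Sum>z\<in>B. real (dD v z) * x z) = 1 * sum x B"
      using v_notin BD by (intro coeff) (auto simp: dD_def)
    moreover have "dD v v = 0" "dD v u = 1" using u v uv v_notin by (auto simp: dD_def)
    ultimately show ?thesis unfolding rsum_def sum_V by simp
  qed
  show "rsum w = 3 * sum x P + 2 * x u + 2 * sum x Wd + x v + 2 * sum x B
      - sum x (child (up w)) - x w" if w: "w \<in> B"
  proof -
    have f: "up w \<in> F" using B_up[OF w] .
    have "(\<Sum>z\<in>P. real (dD w z) * x z) = 3 * sum x P"
      using PD w BD by (intro coeff) (auto simp: dD_def)
    moreover have "(\<Sum>z\<in>Wd. real (dD w z) * x z) = 2 * sum x Wd"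
      using w Wd_cases by (intro coeff) (auto simp: dD_def)
    moreover have "(\<Sum>z\<in>B. real (dD w z) * x z) = 2 * sum x B - sum x (child (up w)) - x w"
    proof -
      have "(\<Sum>z\<in>B. real (dD w z) * x z)
         = (\<Sum>z\<in>B. 2 * x z - (if z \<in> child (up w) then x z else 0) - (if z = w then x w else 0))"
        using w child_F[OF f] by (intro sum.cong) (auto simp: dD_def)
      also have "\<dots> = 2 * sum x B - sum x (B \<inter> child (up w)) - x w"
        using w finite_parts by (simp add: sum_subtractf sum_distrib_left sum.inter_restrict)
      also have "B \<inter> child (up w) = child (up w)" using child_sub_B[OF f] by blast
      finally show ?thesis .
    qed
    moreover have "dD w u = 2" "dD w v = 1" using w uv BD[OF w] v_notin by (auto simp: dD_def)
    ultimately show ?thesis unfolding rsum_def sum_V by simp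
  qed
qed

lemma dD_pos:
  assumes "y \<noteq> z"
  shows "dD y z > 0"
proof -
  have "dD y z \<noteq> 0" using assms unfolding dD_def by (metis zero_neq_one zero_neq_numeral)
  then show ?thesis by simp
qed

text \<open>Constancy on the classes is read off the row sums directly, without appeal to uniqueness
  of the Perron vector or to automorphisms of \<open>D\<close>.\<close>

lemma Perron_D:
  obtains x \<alpha> \<gamma> \<epsilon> where
    "\<forall>y\<in>P. x y = \<alpha>" "\<forall>y\<in>Wd. x y = \<gamma>" "\<forall>y\<in>B. x y = \<epsilon>"
    "double_star_system (distance_spectral_radius D + 1) c M \<alpha> (x u) \<gamma> (x v) \<epsilon>"
    "hg_form D x = distance_spectral_radius D * (\<Sum>v\<in>V. (x v)\<^sup>2)"
proof -
  define r where "r = distance_spectral_radius D"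
  have V: "finite V" "V \<noteq> {}" using finite_V uvV by auto
  obtain x where x: "\<And>v. x v \<ge> 0" "\<exists>v\<in>V. x v \<noteq> 0"
    "\<And>w. w \<in> V \<Longrightarrow> (\<Sum>z\<in>V. real (hg_distance D w z) * x z) = r * x w"
  proof -
    have "\<exists>x. (\<forall>v. x v \<ge> 0) \<and> (\<exists>v\<in>V. x v \<noteq> 0) \<and>
        (\<forall>w\<in>V. (\<Sum>z\<in>V. real (hg_distance D w z) * x z) = r * x w)"
      using distance_spectral_radius_Perron(2)[of D] V hg_distance_sym[OF hypergraph_D]
      unfolding r_def hverts_D by blast
    then show ?thesis using that by blast
  qed
  have row_eq: "(\<Sum>z\<in>V. real (dD w z) * x z) = r * x w" if "w \<in> V" for w
    using x(3)[OF that] hg_distance_D[OF that] by simp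
  \<comment> \<open>All off-diagonal distances are positive. If the row sum of \<open>w\<close> were
    zero, \<open>x\<close> would vanish off \<open>w\<close>, and the row of a second vertex would
    make it vanish at \<open>w\<close> as well.\<close>
  have pos: "r * x w > 0" if w: "w \<in> V" for w
  proof -
    obtain v0 where v0: "v0 \<in> V" "x v0 > 0" using x(1,2) by (metis order_less_le)
    have "(\<Sum>z\<in>V. real (dD w z) * x z) \<noteq> 0"
    proof
      assume "(\<Sum>z\<in>V. real (dD w z) * x z) = 0"
      then have zero: "real (dD w z) * x z = 0" if "z \<in> V" for z
        using that x(1) V by (subst (asm) sum_nonneg_eq_0_iff) auto
      have w0: "v0 = w" using zero[OF v0(1)] v0(2) dD_pos[of w v0] by auto
      obtain z where z: "z \<in> V" "z \<noteq> w" using uvV uv by metis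
      then have "x z = 0" using zero[OF z(1)] dD_pos[of w z] by auto
      then have "(\<Sum>t\<in>V. real (dD z t) * x t) = 0" using row_eq[OF z(1)] by simp
      then have "real (dD z v0) * x v0 = 0"
        using v0(1) x(1) V by (subst (asm) sum_nonneg_eq_0_iff) auto
      then show False using v0(2) dD_pos[of z v0] z w0 by auto
    qed
    moreover have "(\<Sum>z\<in>V. real (dD w z) * x z) \<ge> 0" using x(1) by (intro sum_nonneg) auto
    ultimately show ?thesis using row_eq[OF w] by linarith
  qed
  have rpos: "r > 0" and xpos: "x w > 0" if "w \<in> V" for w
    using pos[OF that] x(1)[of w] by (auto simp: zero_less_mult_iff)
  have r: "r > 0" using rpos[OF uvV(1)] .
  define R where "R = r + 1"
  have R: "R > 0" using r by (simp add: R_def)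
  have Rx: "R * x w = (\<Sum>z\<in>V. real (dD w z) * x z) + x w" if "w \<in> V" for w
    using row_eq[OF that] by (simp add: R_def algebra_simps)
  define \<alpha> where "\<alpha> = (sum x P + x u + 2 * sum x Wd + 2 * x v + 3 * sum x B) / R"
  define \<gamma> where "\<gamma> = (2 * sum x P + x u + sum x Wd + x v + 2 * sum x B) / R"
  define T where "T = 3 * sum x P + 2 * x u + 2 * sum x Wd + x v + 2 * sum x B"
  define \<epsilon> where "\<epsilon> = T / (R + c)"
  have P: "x y = \<alpha>" if "y \<in> P" for y
  proof -
    have "y \<in> V" using that P_outside by blast
    then have "R * x y = R * \<alpha>"
      unfolding Rx[OF \<open>y \<in> V\<close>] row_sums(1)[OF that] using R by (simp add: \<alpha>_def)
    then show ?thesis using R by simp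
  qed
  have W: "x y = \<gamma>" if "y \<in> Wd" for y
  proof -
    have "y \<in> V" using that Wd_cases by blast
    then have "R * x y = R * \<gamma>"
      unfolding Rx[OF \<open>y \<in> V\<close>] row_sums(3)[OF that] using R by (simp add: \<gamma>_def)
    then show ?thesis using R by simp
  qed
  have B: "x y = \<epsilon>" if "y \<in> B" for y
  proof -
    let ?C = "child (up y)"
    have f: "up y \<in> F" using B_up[OF that] .
    have eq: "R * x z = T - sum x ?C" if z: "z \<in> ?C" for z
    proof -
      have zB: "z \<in> B" "up z = up y" using child_F[OF f] z by auto
      then have "z \<in> V" using B_sub by blast
      show ?thesis unfolding Rx[OF \<open>z \<in> V\<close>] row_sums(5)[OF zB(1)] zB(2) by (simp add: T_def)
    qed
    \<comment> \<open>Summing the equations over the petal determines the petal sum; substituting it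
      back gives every entry the value \<open>T / (R + c)\<close>.\<close>
    have "R * sum x ?C = c * (T - sum x ?C)"
      using eq card_child_F[OF f] by (simp add: sum_distrib_left)
    moreover have "y \<in> ?C" using child_F[OF f] that by blast
    note eq[OF this]
    ultimately have "(R + c) * sum x ?C = c * T" "R * x y = T - sum x ?C"
      by (simp_all add: algebra_simps)
    then have "(R + c) * (R * x y) = R * T" by (simp add: right_diff_distrib distrib_right)
    then have "R * ((R + c) * x y) = R * T" by (simp only: mult.left_commute)
    then have "(R + c) * x y = T" using R mult_left_cancel[of R] by blast
    then show ?thesis using R by (simp add: \<epsilon>_def field_simps)
  qed
  have sums: "sum x P = c * \<alpha>" "sum x Wd = (c - 1) * \<gamma>" "sum x B = M * \<epsilon>"
    using P W B card_parts by simp_all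
  have nonneg: "sum x P \<ge> 0" "sum x Wd \<ge> 0" "sum x B \<ge> 0" using x(1) by (auto intro: sum_nonneg)
  have sys: "double_star_system R c M \<alpha> (x u) \<gamma> (x v) \<epsilon>"
  proof
    show "\<alpha> > 0" "\<gamma> > 0"
      unfolding \<alpha>_def \<gamma>_def using nonneg xpos[OF uvV(1)] xpos[OF uvV(2)] R
      by (auto intro!: divide_pos_pos)
    show "\<epsilon> > 0"
      unfolding \<epsilon>_def T_def using nonneg xpos[OF uvV(1)] xpos[OF uvV(2)] R
      by (auto intro!: divide_pos_pos)
    show "x u > 0" "x v > 0" using xpos uvV by auto
    show "1 \<le> c" using k by simp
    show "c \<le> M" by (rule M_ge_c)
    show "R * \<alpha> = c * \<alpha> + x u + 2 * ((c - 1) * \<gamma>) + 2 * x v + 3 * (M * \<epsilon>)"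
      unfolding sums[symmetric] using R by (simp add: \<alpha>_def)
    show "R * \<gamma> = 2 * (c * \<alpha>) + x u + (c - 1) * \<gamma> + x v + 2 * (M * \<epsilon>)"
      unfolding sums[symmetric] using R by (simp add: \<gamma>_def)
    show "R * x u = c * \<alpha> + x u + (c - 1) * \<gamma> + x v + 2 * (M * \<epsilon>)"
      unfolding sums[symmetric] Rx[OF uvV(1)] row_sums(2) by simp
    show "R * x v = 2 * (c * \<alpha>) + x u + (c - 1) * \<gamma> + x v + M * \<epsilon>"
      unfolding sums[symmetric] Rx[OF uvV(2)] row_sums(4) by simp
    have "(R + c) * \<epsilon> = T" using R by (simp add: \<epsilon>_def)
    then show "R * \<epsilon> = 3 * (c * \<alpha>) + 2 * x u + 2 * ((c - 1) * \<gamma>) + x v + 2 * (M * \<epsilon>) - c * \<epsilon>"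
      unfolding sums[symmetric] T_def by (simp add: algebra_simps)
  qed
  have form: "hg_form D x = r * (\<Sum>v\<in>V. (x v)\<^sup>2)"
    unfolding hg_form_def hverts_D by (rule quad_form_eigenvector) (rule x(3))
  show ?thesis
    by (rule that[of x \<alpha> \<gamma> \<epsilon>]) (use P W B sys form in \<open>simp_all add: R_def r_def\<close>)
qed

end

section \<open>Comparison of the quadratic forms\<close>

context branching
begin

text \<open>Lower bounds for the distance in \<open>G\<close> minus \<open>dD\<close>, with parents
  left aside. Between different branches the distance is at least
  \<open>1 + height y + height z\<close>; inside the branch at \<open>v\<close>, the distance to
  \<open>v\<close> is at least \<open>height y\<close>; nonadjacent vertices are at distance at
  least 2. The value -1 is the loss towards \<open>P\<close> in the branch at \<open>u\<close>,
  distance 2 against 3. For two vertices of \<open>B\<close>, one in the branch at \<open>v\<close>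
  and one not, the whole credit goes to the row of the latter, which thereby collects from the
  entire branch at \<open>v\<close>.\<close>

definition gain :: "'a \<Rightarrow> 'a \<Rightarrow> int" where
  "gain y z =
    (if z = v then (if root y = v then height y - 1 else height y)
     else if z = u then (if root y = u then 0 else height y - 1)
     else if z \<in> P then (if root y = u then - 1 else height y - 1)
     else if z \<in> B \<and> root y \<noteq> v \<and> root z = v then height y
     else 0)"

text \<open>
  Lower bound for the part of \<open>hg_distance G y z - dD y z\<close> charged to the edge above \<open>y\<close>. The
  indicator pays for \<open>y\<close> being adjacent in \<open>G\<close> to its parent instead of to \<open>v\<close>.
\<close>

definition charge :: "'a \<Rightarrow> 'a \<Rightarrow> int" where
  "charge y z = (if y \<in> B then gain y z - of_bool (z = par (up y) \<and> z \<noteq> v) else 0)"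

lemma B_facts: "y \<in> B \<Longrightarrow> y \<in> V \<and> y \<notin> e \<and> y \<notin> P \<and> y \<noteq> u \<and> y \<noteq> v \<and> 1 \<le> height y"
  using v_notin height_range by (auto simp: B_def)

lemma charge_outside: "y \<notin> B \<Longrightarrow> charge y z = 0"
  by (simp add: charge_def)

text \<open>In different branches the bound by heights applies, and the credited vertex leaves the
  other one height at least 1 to spare. In a common branch both gains are 0, and \<open>G\<close>
  beats \<open>dD\<close> only for a parent and its child, which the indicator covers.\<close>

lemma charge_le_distance_diff_B_B:
  assumes y: "y \<in> B" and z: "z \<in> B" and ne: "y \<noteq> z"
  shows "charge y z + charge z y \<le> int (hg_distance G y z) - int (dD y z)"
proof -
  have yV: "y \<in> V" and zV: "z \<in> V" using y z B_facts by blast+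
  have hy: "1 \<le> height y" and hz: "1 \<le> height z" using y z B_facts by blast+
  have d1: "hg_distance G y z \<ge> 1" using hg_distance_ge_1[OF yV zV ne] .
  have gains: "gain y z = (if root y \<noteq> v \<and> root z = v then height y else 0)"
    "gain z y = (if root z \<noteq> v \<and> root y = v then height z else 0)"
    using B_facts[OF y] B_facts[OF z] y z by (auto simp: gain_def)
  have dD: "dD y z = (if up y = up z then 1 else 2)" using y z ne by (simp add: dD_def)
  have charges: "charge y z \<le> gain y z" "charge z y \<le> gain z y"
    by (simp_all add: charge_def y z)
  show ?thesis
  proof (cases "root y = root z")
    case True
    then have g0: "gain y z = 0" "gain z y = 0" using gains by auto
    show ?thesis
    proof (cases "(y, z) \<in> hadj E")
      case False
      then have "hg_distance G y z \<ge> 2" using hg_distance_ge_2[OF yV zV ne] by blast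
      then show ?thesis using g0 charges dD by (auto split: if_splits)
    next
      case True
      have "y \<notin> e \<or> z \<notin> e" using B_facts[OF y] by blast
      with True show ?thesis
      proof (cases rule: hadj_cases)
        case 1
        then show ?thesis using g0 charges dD d1 by simp
      next
        case 2
        then have "charge y z = - 1" using y g0 B_facts[OF z] by (simp add: charge_def)
        then show ?thesis using g0 charges dD d1 by (simp split: if_splits)
      next
        case 3
        then have "charge z y = - 1" using z g0 B_facts[OF y] by (simp add: charge_def)
        then show ?thesis using g0 charges dD d1 by (simp split: if_splits)
      qed
    qed
  next
    case False
    then have "int (hg_distance G y z) \<ge> 1 + height y + height z"
      by (rule hg_distance_different_roots[OF yV zV])
    then show ?thesis using gains charges dD hy hz by (auto split: if_splits)
  qed
qed

lemma charge_le_distance_diff_B: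
  assumes y: "y \<in> B" and z: "z \<in> V" "z \<notin> B"
  shows "charge y z \<le> int (hg_distance G y z) - int (dD y z)"
proof -
  have yV: "y \<in> V" and ne: "y \<noteq> z" and hy: "1 \<le> height y" and ye: "y \<notin> e"
    using y z B_facts by blast+
  have d1: "hg_distance G y z \<ge> 1" using hg_distance_ge_1[OF yV z(1) ne] .
  have dD: "dD y z = (if z = v then 1 else if z \<in> P then 3 else 2)"
    using y z ne by (simp add: dD_def)
  have charge: "charge y z \<le> gain y z" by (simp add: charge_def y)
  have far: "int (hg_distance G y z) \<ge> 1 + height y + height z" if "root y \<noteq> root z"
    using hg_distance_different_roots[OF yV z(1) that] .
  \<comment> \<open>A neighbour of \<open>y\<close> outside \<open>B\<close> must be its parent:
    siblings and children of \<open>y\<close> belong to moved edges and hence to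
    \<open>B\<close>.\<close>
  have nonadj: "z = par (up y) \<or> hg_distance G y z \<ge> 2"
  proof (cases "(y, z) \<in> hadj E")
    case True
    have "y \<notin> e \<or> z \<notin> e" using ye by blast
    with True show ?thesis
    proof (cases rule: hadj_cases)
      case 1
      then have "z \<in> P" using z by (auto simp: B_def)
      then have "up y = g" using 1 up_P by simp
      then show ?thesis using B_up[OF y] by (simp add: F_def)
    next
      case 3
      then have "z \<in> P" using z by (auto simp: B_def)
      then have "y = u" using 3 up_P par_g by simp
      then show ?thesis using B_facts[OF y] by blast
    qed simp
  qed (use hg_distance_ge_2[OF yV z(1) ne] in blast)
  show ?thesis
  proof (cases "z \<in> P")
    case True
    then have zz: "root z = u" "height z = 1" "z \<noteq> u" "z \<noteq> v"
      using root_P height_P v_notin by auto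
    show ?thesis
    proof (cases "root y = u")
      case True
      then have "charge y z = - 1 - of_bool (z = par (up y))"
        using zz \<open>z \<in> P\<close> y by (simp add: charge_def gain_def)
      then show ?thesis using nonadj d1 dD \<open>z \<in> P\<close> zz by (auto simp: of_bool_def)
    next
      case False
      then show ?thesis using far charge dD \<open>z \<in> P\<close> zz by (simp add: gain_def)
    qed
  next
    case False
    then have ze: "z \<in> e" using z by (auto simp: B_def)
    then have zz: "root z = z" "height z = 0" using root_in_e by (auto simp: height_def)
    have h1: "height y = 1" if "z = par (up y)" using that ze ye by (simp add: height_def)
    show ?thesis
    proof (cases "root y = z")
      case True
      show ?thesis
      proof (cases "z = par (up y)")
        case True
        then have "charge y z = gain y z - of_bool (z \<noteq> v)" using y by (simp add: charge_def)
        moreover have "gain y z = 0"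
          using h1[OF True] \<open>root y = z\<close> False z(2) by (simp add: gain_def)
        ultimately show ?thesis using d1 dD False by (cases "z = v") simp_all
      next
        case par: False
        then have "hg_distance G y z \<ge> 2" using nonadj by blast
        then show ?thesis
          using charge dD False \<open>root y = z\<close> z(2) height_range[of y] by (auto simp: gain_def split: if_splits)
      qed
    next
      case root: False
      then have "int (hg_distance G y z) \<ge> 1 + height y" using far zz by simp
      then show ?thesis
        using charge dD False root z(2) hy by (auto simp: gain_def split: if_splits)
    qed
  qed
qed

text \<open>The edges \<open>e\<close> and \<open>g\<close> stay in place, and two distinct vertices
  outside \<open>B\<close> that share neither of them are nonadjacent in \<open>G\<close>, while
  \<open>dD\<close> is 2.\<close>

lemma dD_le_outside_B:
  assumes y: "y \<in> V" "y \<notin> B" and z: "z \<in> V" "z \<notin> B"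
  shows "dD y z \<le> hg_distance G y z"
proof (cases "y = z \<or> y \<in> e \<and> z \<in> e \<or> y \<in> g \<and> z \<in> g")
  case True
  then show ?thesis using y z hg_distance_ge_1[OF y(1) z(1)] by (auto simp: dD_def)
next
  case False
  have "(y, z) \<notin> hadj E"
  proof
    assume adj: "(y, z) \<in> hadj E"
    have "y \<notin> e \<or> z \<notin> e" using False by blast
    have *: "w \<in> g \<and> par (up w) = u \<and> up w = g" if "w \<notin> e" "w \<in> {y, z}" for w
      using that y z up_P par_g by (auto simp: B_def P_eq)
    from adj \<open>y \<notin> e \<or> z \<notin> e\<close> show False
      using False * g(3) by (cases rule: hadj_cases) auto
  qed
  then have "hg_distance G y z \<ge> 2" using False hg_distance_ge_2[OF y(1) z(1)] by blast
  then show ?thesis using y z by (simp add: dD_def)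
qed

lemma charge_le_distance_diff:
  assumes y: "y \<in> V" and z: "z \<in> V"
  shows "charge y z + charge z y \<le> int (hg_distance G y z) - int (dD y z)"
proof (cases "y = z")
  case True
  have "charge y y \<le> 0"
    using B_facts[of y] by (auto simp: charge_def gain_def)
  then show ?thesis using True by (simp add: dD_def)
next
  case False
  consider "y \<in> B" "z \<in> B" | "y \<in> B" "z \<notin> B" | "y \<notin> B" "z \<in> B" | "y \<notin> B" "z \<notin> B" by blast
  then show ?thesis
  proof cases
    case 1
    then show ?thesis using charge_le_distance_diff_B_B False by blast
  next
    case 2
    then show ?thesis using charge_le_distance_diff_B[OF 2(1) z 2(2)] charge_outside by simp
  next
    case 3
    then show ?thesis
      using charge_le_distance_diff_B[OF 3(2) y 3(1)] charge_outside
        hg_distance_sym[OF hyper y z] dD_sym by simp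
  next
    case 4
    then show ?thesis using dD_le_outside_B[OF y 4(1) z 4(2)] charge_outside by simp
  qed
qed

text \<open>The row depends only on the branch and the height of \<open>y\<close> and on its parent,
  which leaves a handful of cases for the sign.\<close>

lemma charge_row_sum:
  fixes x :: "'a \<Rightarrow> real"
  assumes P: "\<forall>z\<in>P. x z = \<alpha>" and B: "\<forall>z\<in>B. x z = \<epsilon>" and y: "y \<in> B"
  shows "(\<Sum>z\<in>V. of_int (charge y z) * x z) =
      of_int (if root y = u then - 1 else height y - 1) * (c * \<alpha>)
    + of_int (if root y = u then 0 else height y - 1) * x u
    + of_int (if root y = v then height y - 1 else height y) * x v
    + of_int (if root y = v then 0 else height y) * (real (card (branch v)) * \<epsilon>)
    - (if par (up y) = v then 0 else x (par (up y)))"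
proof -
  let ?p = "par (up y)"
  have pV: "?p \<in> V" using B_up[OF y] par(1)[of "up y"] edge_sub[of "up y"] by (auto simp: F_def)
  have "(\<Sum>z\<in>V. of_int (charge y z) * x z)
      = (\<Sum>z\<in>V. of_int (gain y z) * x z - (if z = ?p then if ?p = v then 0 else x ?p else 0))"
    by (intro sum.cong) (auto simp: charge_def y algebra_simps)
  also have "\<dots> = (\<Sum>z\<in>V. of_int (gain y z) * x z) - (if ?p = v then 0 else x ?p)"
    using finite_V pV by (simp add: sum_subtractf)
  also have "(\<Sum>z\<in>V. of_int (gain y z) * x z) =
      (\<Sum>z\<in>P. of_int (gain y z) * x z) + of_int (gain y u) * x u + (\<Sum>z\<in>Wd. of_int (gain y z) * x z)
      + of_int (gain y v) * x v + (\<Sum>z\<in>B. of_int (gain y z) * x z)"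
    by (rule sum_V)
  also have "(\<Sum>z\<in>P. of_int (gain y z) * x z)
      = (\<Sum>z\<in>P. of_int (if root y = u then - 1 else height y - 1) * \<alpha>)"
    using v_notin P by (intro sum.cong) (auto simp: gain_def)
  also have "\<dots> = of_int (if root y = u then - 1 else height y - 1) * (c * \<alpha>)"
    using card_parts by simp
  also have "(\<Sum>z\<in>Wd. of_int (gain y z) * x z) = 0"
    using Wd_cases by (intro sum.neutral) (auto simp: gain_def)
  also have "(\<Sum>z\<in>B. of_int (gain y z) * x z)
      = (\<Sum>z\<in>B. if z \<in> branch v then of_int (if root y = v then 0 else height y) * \<epsilon> else 0)"
    using B_facts B by (intro sum.cong) (auto simp: gain_def branch_def)
  also have "\<dots> = (\<Sum>z\<in>branch v. of_int (if root y = v then 0 else height y) * \<epsilon>)"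
  proof -
    have "B \<inter> branch v = branch v" using branch_v_sub by blast
    then show ?thesis using finite_parts by (simp flip: sum.inter_restrict)
  qed
  finally show ?thesis using uv by (simp add: gain_def)
qed

text \<open>The position of the parent decides who pays: \<open>\<beta>_bound\<close> in the branch
  at \<open>u\<close>, \<open>\<gamma>_bound\<close> for a parent in \<open>Wd\<close>,
  \<open>\<epsilon>_bound\<close> for a parent in \<open>B\<close> outside the branch at
  \<open>u\<close>. With parent \<open>v\<close>, the vertex has root \<open>v\<close> and height 1,
  and all terms vanish.\<close>

lemma charge_row_sum_sign:
  assumes x: "\<forall>z\<in>P. x z = \<alpha>" "\<forall>z\<in>Wd. x z = \<gamma>" "\<forall>z\<in>B. x z = \<epsilon>"
    and sys: "double_star_system R c M \<alpha> (x u) \<gamma> (x v) \<epsilon>" and y: "y \<in> B"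
  shows "par (up y) = v \<Longrightarrow> (\<Sum>z\<in>V. of_int (charge y z) * x z) = 0"
    and "par (up y) \<noteq> v \<Longrightarrow> (\<Sum>z\<in>V. of_int (charge y z) * x z) > 0"
proof -
  interpret double_star_system R c M \<alpha> "x u" \<gamma> "x v" \<epsilon> by (rule sys)
  let ?p = "par (up y)"
  let ?n = "real (card (branch v))"
  note row = charge_row_sum[of x, OF x(1,3) y]
  have f: "up y \<in> E" "up y \<noteq> e" using B_up[OF y] by (auto simp: F_def)
  have pV: "?p \<in> V" using par(1)[OF f] edge_sub[OF f(1)] by blast
  have "y \<in> up y" using child_F[OF B_up[OF y]] y by (auto simp: child_def)
  then have root_p: "root ?p = root y" using root_edge[OF f par(1)[OF f]] by blast
  have h: "height y = (if ?p \<in> e then 1 else 2)" using B_facts[OF y] by (simp add: height_def)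
  have root_pe: "root y = ?p" if "?p \<in> e" using root_in_e[OF that] root_p by simp
  show "(\<Sum>z\<in>V. of_int (charge y z) * x z) = 0" if pv: "?p = v"
  proof -
    have "root y = v" "height y = 1" using pv v root_pe h by simp_all
    then show ?thesis unfolding row using pv uv by simp
  qed
  have n\<epsilon>: "?n * \<epsilon> \<ge> c * \<epsilon>" using card_branch_v pos by simp
  have \<epsilon>c: "c * \<epsilon> \<ge> \<epsilon>" using c pos by simp
  show "(\<Sum>z\<in>V. of_int (charge y z) * x z) > 0" if pv: "?p \<noteq> v"
  proof (cases "root y = u")
    case True
    have n: "?n * \<epsilon> \<ge> 2 * (c * \<epsilon>)"
      using two_branches(1)[OF y True] pos by (simp flip: mult.assoc)
    have key: "x u + c * \<alpha> < x v + 2 * (c * \<epsilon>)" using \<beta>_bound two_branches(2)[OF y True] .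
    show ?thesis
    proof (cases "?p \<in> e")
      case True
      then have "?p = u" using root_pe \<open>root y = u\<close> by simp
      then show ?thesis unfolding row using \<open>root y = u\<close> uv u h n key by simp
    next
      case False
      then have "x ?p = \<alpha> \<or> x ?p = \<epsilon>" using pV x by (auto simp: B_def)
      then have "x ?p \<le> c * \<alpha> \<or> x ?p \<le> c * \<epsilon>" using c_\<alpha> \<epsilon>c by auto
      \<comment> \<open>At height 2 the credits at \<open>v\<close> and on its branch count twice.
        Twice \<open>key\<close> covers a parent of value at most \<open>c * \<alpha>\<close>, and
        \<open>key\<close> once covers one of value at most \<open>c * \<epsilon>\<close>.\<close>
      then have "x ?p < 2 * x v - c * \<alpha> + 2 * (?n * \<epsilon>)" using n key pos \<epsilon>c by linarith
      then show ?thesis unfolding row using False \<open>root y = u\<close> pv uv h by simp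
    qed
  next
    case ru: False
    show ?thesis
    proof (cases "?p \<in> e")
      case True
      then have rp: "root y = ?p" by (rule root_pe)
      then have "?p \<in> Wd" using True ru pv by (auto simp: Wd_def)
      then have "x ?p = \<gamma>" using x(2) by blast
      then show ?thesis unfolding row using True rp ru pv h \<gamma>_bound n\<epsilon> by simp
    next
      case False
      moreover have "?p \<notin> P" using root_P root_p ru by metis
      ultimately have "x ?p = \<epsilon>" using pV x(3) by (auto simp: B_def)
      then have p1: "x ?p < c * \<alpha> + x u + x v" using \<epsilon>_bound by simp
      have "?n * \<epsilon> \<ge> 0" using pos by simp
      then have "x ?p < c * \<alpha> + x u + 2 * x v + 2 * (?n * \<epsilon>)" using p1 pos by linarith
      with p1 show ?thesis
        unfolding row using False pv ru h by (cases "root y = v") simp_all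
    qed
  qed
qed

text \<open>The equality case: when every parent already is \<open>v\<close>, nothing moves, so
  \<open>D\<close> is literally \<open>G\<close> and not merely isomorphic to it.\<close>

lemma all_par_v_imp_D:
  assumes "\<And>y. y \<in> B \<Longrightarrow> par (up y) = v"
  shows "D = G"
proof -
  have "insert v (child f) = f" if f: "f \<in> F" for f
  proof -
    have "card (child f) \<noteq> 0" using card_child_F[OF f] k by simp
    then obtain y where "y \<in> child f" by (metis card_eq_0_iff ex_in_conv)
    then have "par f = v" using assms child_F[OF f] by auto
    then show ?thesis using par(1)[of f] f by (auto simp: child_def F_def)
  qed
  then have "(\<lambda>f. insert v (child f)) ` F = F" by simp
  then have "hedges D = E" using e g(1) by (auto simp: D_def F_def)
  then show ?thesis by (metis hverts_D hypergraph.exhaust_sel)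
qed

theorem distance_spectral_radius_D_le:
  "distance_spectral_radius D \<le> distance_spectral_radius G"
  "distance_spectral_radius D = distance_spectral_radius G \<Longrightarrow> D = G"
proof -
  obtain x \<alpha> \<gamma> \<epsilon> where x: "\<forall>y\<in>P. x y = \<alpha>" "\<forall>y\<in>Wd. x y = \<gamma>" "\<forall>y\<in>B. x y = \<epsilon>"
    and sys: "double_star_system (distance_spectral_radius D + 1) c M \<alpha> (x u) \<gamma> (x v) \<epsilon>"
    and form: "hg_form D x = distance_spectral_radius D * (\<Sum>v\<in>V. (x v)\<^sup>2)"
    by (rule Perron_D) (rule that)
  interpret double_star_system "distance_spectral_radius D + 1" c M \<alpha> "x u" \<gamma> "x v" \<epsilon> by (rule sys)
  define K where "K = (\<lambda>y. \<Sum>z\<in>V. real_of_int (charge y z) * x z)"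
  have xpos: "x y > 0" if "y \<in> V" for y
    using that x pos V_cases[OF that] by (cases "y = u \<or> y = v") (auto simp: Wd_def)
  have K: "K y \<ge> 0" "par (up y) \<noteq> v \<Longrightarrow> K y > 0" if "y \<in> B" for y
    using charge_row_sum_sign[OF x sys that] unfolding K_def by (cases "par (up y) = v"; simp)+
  have V: "V \<noteq> {}" "finite V" using uvV finite_V by auto
  have "hg_form G x - hg_form D x
      = (\<Sum>y\<in>V. \<Sum>z\<in>V. real_of_int (int (hg_distance G y z) - int (dD y z)) * x y * x z)"
    unfolding hg_form_def quad_form_def hverts_D sum_subtractf[symmetric]
    by (intro sum.cong refl) (simp add: hg_distance_D algebra_simps)
  also have "\<dots> \<ge> (\<Sum>y\<in>V. \<Sum>z\<in>V. real_of_int (charge y z + charge z y) * x y * x z)"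
  proof (intro sum_mono)
    fix y z assume yz: "y \<in> V" "z \<in> V"
    have "real_of_int (charge y z + charge z y) * (x y * x z)
       \<le> real_of_int (int (hg_distance G y z) - int (dD y z)) * (x y * x z)"
      using charge_le_distance_diff[OF yz] xpos[OF yz(1)] xpos[OF yz(2)]
      by (intro mult_right_mono) (simp_all only: of_int_le_iff, simp)
    then show "real_of_int (charge y z + charge z y) * x y * x z
       \<le> real_of_int (int (hg_distance G y z) - int (dD y z)) * x y * x z" by (simp only: mult.assoc)
  qed
  \<comment> \<open>Swapping the summations merges the two charges of a pair, so the estimate splits
    into one row sum for each moved vertex.\<close>
  also have "(\<Sum>y\<in>V. \<Sum>z\<in>V. real_of_int (charge y z + charge z y) * x y * x z) = 2 * (\<Sum>y\<in>V. x y * K y)"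
  proof -
    have "(\<Sum>y\<in>V. \<Sum>z\<in>V. real_of_int (charge z y) * x y * x z)
        = (\<Sum>y\<in>V. \<Sum>z\<in>V. real_of_int (charge y z) * x z * x y)"
      by (rule sum.swap)
    then show ?thesis
      by (simp add: K_def sum_distrib_left algebra_simps sum.distrib)
  qed
  also have "(\<Sum>y\<in>V. x y * K y) = (\<Sum>y\<in>B. x y * K y)"
    using finite_V B_sub by (intro sum.mono_neutral_right) (auto simp: K_def charge_outside)
  finally have diff: "2 * (\<Sum>y\<in>B. x y * K y) \<le> hg_form G x - hg_form D x" .
  have nn: "x y * K y \<ge> 0" if "y \<in> B" for y
    using that K xpos[of y] B_sub by (simp add: less_imp_le subset_iff)
  define S where "S = (\<Sum>v\<in>V. (x v)\<^sup>2)"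
  have S: "S > 0" unfolding S_def using V xpos by (intro sum_pos) (auto simp: less_le)
  have G: "hg_form G x \<le> distance_spectral_radius G * S"
    unfolding S_def using V hg_distance_sym[OF hyper]
    by (intro distance_spectral_radius_Perron(1)) auto
  have total: "distance_spectral_radius D * S + 2 * (\<Sum>y\<in>B. x y * K y) \<le> distance_spectral_radius G * S"
    using diff G form by (simp add: S_def)
  have "(\<Sum>y\<in>B. x y * K y) \<ge> 0" using nn by (rule sum_nonneg)
  then have "distance_spectral_radius D * S \<le> distance_spectral_radius G * S" using total by linarith
  then show "distance_spectral_radius D \<le> distance_spectral_radius G" using S by simp
  assume eq: "distance_spectral_radius D = distance_spectral_radius G"
  show "D = G"
  proof (rule all_par_v_imp_D, rule ccontr)
    fix y assume y: "y \<in> B" "par (up y) \<noteq> v"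
    have "x y * K y > 0" using K(2)[OF y] xpos[of y] y B_sub by auto
    then have "(\<Sum>y\<in>B. x y * K y) > 0"
      using y(1) nn finite_parts by (meson sum_pos2)
    with total eq show False by simp
  qed
qed

end

section \<open>Labelling the comparison hypertree\<close>

text \<open>Number the blocks, and the elements within each block. Disjointness makes the block of
  an element well defined, so the two numbers together form a label \<open>Leaf\<close>.\<close>

lemma petal_labelling:
  assumes F: "finite F" and C: "\<And>f. f \<in> F \<Longrightarrow> finite (C f) \<and> card (C f) = k - 1"
    and disj: "\<And>f f' y. f \<in> F \<Longrightarrow> f' \<in> F \<Longrightarrow> y \<in> C f \<Longrightarrow> y \<in> C f' \<Longrightarrow> f = f'"
  obtains \<phi> where "inj_on \<phi> (\<Union>f\<in>F. C f)" "(\<lambda>f. \<phi> ` C f) ` F = petal k ` {..<card F}"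
proof -
  obtain i where i: "bij_betw i F {..<card F}"
    using ex_bij_betw_finite_nat[OF F] by (auto simp: lessThan_atLeast0)
  have "\<exists>j. bij_betw j (C f) {..<k - 1}" if "f \<in> F" for f
    using ex_bij_betw_finite_nat[of "C f"] C[OF that] by (auto simp: lessThan_atLeast0)
  then obtain j where j: "\<And>f. f \<in> F \<Longrightarrow> bij_betw (j f) (C f) {..<k - 1}" by metis
  define blk where "blk = (\<lambda>y. THE f. f \<in> F \<and> y \<in> C f)"
  have blk: "blk y = f" if "f \<in> F" "y \<in> C f" for f y
    unfolding blk_def using that disj by (intro the_equality) auto
  define \<phi> where "\<phi> = (\<lambda>y. Leaf (i (blk y)) (j (blk y) y))"
  have "inj_on \<phi> (\<Union>f\<in>F. C f)"
  proof (rule inj_onI)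
    fix y z assume "y \<in> (\<Union>f\<in>F. C f)" "z \<in> (\<Union>f\<in>F. C f)" and eq: "\<phi> y = \<phi> z"
    then obtain f f' where f: "f \<in> F" "y \<in> C f" "f' \<in> F" "z \<in> C f'" by blast
    then have "i f = i f'" "j f y = j f' z" using eq blk by (auto simp: \<phi>_def)
    then show "y = z" using f i j[of f] by (metis bij_betw_def inj_onD)
  qed
  moreover have im: "\<phi> ` C f = petal k (i f)" if "f \<in> F" for f
  proof -
    have "\<phi> ` C f = (\<lambda>y. Leaf (i f) (j f y)) ` C f" using blk[OF that] by (simp add: \<phi>_def)
    also have "\<dots> = Leaf (i f) ` j f ` C f" by (simp add: image_image)
    finally show ?thesis using j[OF that] by (simp add: petal_def bij_betw_def)
  qed
  have "(\<lambda>f. \<phi> ` C f) ` F = petal k ` i ` F" using im by (auto simp: image_image)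
  then have "(\<lambda>f. \<phi> ` C f) ` F = petal k ` {..<card F}" using i by (simp add: bij_betw_def)
  ultimately show ?thesis by (rule that)
qed

lemma hyperstar_eq:
  assumes "k \<ge> 2"
  shows "hyperstar (Suc (m * (k - 1))) k
    = Hypergraph (insert Center (\<Union>(petal k ` {..<m}))) (insert Center ` petal k ` {..<m})"
  using assms by (simp add: hyperstar_def Let_def image_image)

lemma hyperstar_labelling:
  assumes k: "k \<ge> 2" and F: "finite F" and C: "\<And>f. f \<in> F \<Longrightarrow> finite (C f) \<and> card (C f) = k - 1"
    and disj: "\<And>f f' y. f \<in> F \<Longrightarrow> f' \<in> F \<Longrightarrow> y \<in> C f \<Longrightarrow> y \<in> C f' \<Longrightarrow> f = f'"
    and z: "z \<notin> (\<Union>f\<in>F. C f)"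
  obtains \<psi> where
    "bij_betw \<psi> (insert z (\<Union>f\<in>F. C f)) (hverts (hyperstar (Suc (card F * (k - 1))) k))"
    "(\<lambda>f. \<psi> ` insert z (C f)) ` F = hedges (hyperstar (Suc (card F * (k - 1))) k)"
    "\<psi> z = Center"
proof -
  obtain \<phi> where \<phi>: "inj_on \<phi> (\<Union>f\<in>F. C f)" "(\<lambda>f. \<phi> ` C f) ` F = petal k ` {..<card F}"
  proof (rule petal_labelling[of F C k])
    show "f = f'" if "f \<in> F" "f' \<in> F" "y \<in> C f" "y \<in> C f'" for f f' y using disj[OF that] .
  qed (use F C that in auto)
  define \<psi> where "\<psi> = \<phi>(z := Center)"
  have \<psi>: "\<psi> ` insert z (C f) = insert Center (\<phi> ` C f)" if "f \<in> F" for f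
    using that z by (auto simp: \<psi>_def)
  have Un: "\<phi> ` (\<Union>f\<in>F. C f) = \<Union>(petal k ` {..<card F})"
    unfolding \<phi>(2)[symmetric] by blast
  have "Center \<notin> \<phi> ` (\<Union>f\<in>F. C f)" unfolding Un by (auto simp: petal_def)
  moreover have "\<psi> ` (\<Union>f\<in>F. C f) = \<phi> ` (\<Union>f\<in>F. C f)" using z by (auto simp: \<psi>_def)
  moreover have "inj_on \<psi> (\<Union>f\<in>F. C f)"
    using \<phi>(1) z by (auto simp: \<psi>_def inj_on_def)
  ultimately have "bij_betw \<psi> (insert z (\<Union>f\<in>F. C f)) (insert Center (\<Union>(petal k ` {..<card F})))"
    using z Un by (auto simp: bij_betw_def \<psi>_def)
  moreover have "(\<lambda>f. \<psi> ` insert z (C f)) ` F = insert Center ` petal k ` {..<card F}"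
    unfolding \<phi>(2)[symmetric] using \<psi> by (auto simp: image_image)
  moreover have "\<psi> z = Center" by (simp add: \<psi>_def)
  ultimately show ?thesis using that unfolding hyperstar_eq[OF k] by simp
qed

text \<open>All edges pass through \<open>z\<close> and, as there are no cycles, share nothing else;
  the sets \<open>f - {z}\<close> are therefore disjoint petals. Counting them converts the order in
  the statement into the number of edges.\<close>

lemma hyperstar_iso:
  assumes k: "k \<ge> 2" and T: "hypertree T" and unif: "k_uniform k T"
    and z: "z \<in> hverts T" "\<And>f. f \<in> hedges T \<Longrightarrow> z \<in> f"
    and cover: "\<And>y. y \<in> hverts T \<Longrightarrow> y \<noteq> z \<Longrightarrow> \<exists>f\<in>hedges T. y \<in> f"
  shows "hg_iso T (hyperstar (card (hverts T)) k)"
proof -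
  let ?E = "hedges T" and ?V = "hverts T"
  have G: "finite ?V" "\<And>f. f \<in> ?E \<Longrightarrow> f \<subseteq> ?V" using T by (auto simp: hypertree_def hypergraph_def)
  then have E: "finite ?E" by (metis Pow_iff finite_Pow_iff finite_subset subsetI)
  have C: "finite (f - {z}) \<and> card (f - {z}) = k - 1" if "f \<in> ?E" for f
    using that z(2)[OF that] G finite_subset[of f ?V] unif by (simp add: k_uniform_def)
  have disj: "f = f'" if "f \<in> ?E" "f' \<in> ?E" "y \<in> f - {z}" "y \<in> f' - {z}" for f f' y
    using hypertree_edges_meet_once[OF T that(1,2) _, of y z] z(2)[OF that(1)] z(2)[OF that(2)] that(3,4)
    by auto
  have V: "insert z (\<Union>f\<in>?E. f - {z}) = ?V"
  proof
    show "insert z (\<Union>f\<in>?E. f - {z}) \<subseteq> ?V" using z(1) G(2) by auto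
    show "?V \<subseteq> insert z (\<Union>f\<in>?E. f - {z})"
    proof
      fix y assume "y \<in> ?V"
      then show "y \<in> insert z (\<Union>f\<in>?E. f - {z})" using cover[of y] by (cases "y = z") auto
    qed
  qed
  have ins: "insert z (f - {z}) = f" if "f \<in> ?E" for f using z(2)[OF that] by blast
  let ?H = "hyperstar (Suc (card ?E * (k - 1))) k"
  obtain \<psi> where \<psi>: "bij_betw \<psi> (insert z (\<Union>f\<in>?E. f - {z})) (hverts ?H)"
    "(\<lambda>f. \<psi> ` insert z (f - {z})) ` ?E = hedges ?H"
  proof (rule hyperstar_labelling[of k ?E "\<lambda>f. f - {z}" z])
    show "k \<ge> 2" "finite ?E" by fact+
    show "finite (f - {z}) \<and> card (f - {z}) = k - 1" if "f \<in> ?E" for f using C[OF that] .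
    show "f = f'" if "f \<in> ?E" "f' \<in> ?E" "y \<in> f - {z}" "y \<in> f' - {z}" for f f' y
      using disj[OF that] .
  qed (use that in auto)
  have "(\<lambda>f. \<psi> ` insert z (f - {z})) ` ?E = (\<lambda>f. \<psi> ` f) ` ?E"
    by (intro image_cong refl) (simp only: ins)
  then have "hg_iso T ?H" using \<psi> unfolding hg_iso_def V by metis
  moreover have "card ?V = Suc (card ?E * (k - 1))"
  proof -
    have "card (\<Union>f\<in>?E. f - {z}) = (\<Sum>f\<in>?E. card (f - {z}))"
      using E C disj by (intro card_UN_disjoint) blast+
    also have "\<dots> = card ?E * (k - 1)" using C by simp
    finally have "card (\<Union>f\<in>?E. f - {z}) = card ?E * (k - 1)" .
    moreover have "card (insert z (\<Union>f\<in>?E. f - {z})) = Suc (card (\<Union>f\<in>?E. f - {z}))"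
      using E C by (intro card_insert_disjoint) blast+
    ultimately show ?thesis unfolding V by simp
  qed
  ultimately show ?thesis by simp
qed

text \<open>By contraposition: if no edge has two vertices that lie on further edges, then some
  vertex lies on all edges. The centre \<open>z\<close> is the branching vertex of an arbitrary edge
  \<open>e0\<close>, or any vertex of \<open>e0\<close> if it has none.\<close>

lemma not_hyperstar_branching:
  assumes k: "k \<ge> 2" and T: "hypertree T" and unif: "k_uniform k T"
    and ns: "\<not> hg_iso T (hyperstar (card (hverts T)) k)" and two: "card (hverts T) \<ge> 2"
  obtains e u v g h where "e \<in> hedges T" "u \<in> e" "v \<in> e" "u \<noteq> v"
    "g \<in> hedges T" "g \<noteq> e" "u \<in> g" "h \<in> hedges T" "h \<noteq> e" "v \<in> h"
proof -
  let ?E = "hedges T" and ?V = "hverts T"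
  define br where "br = (\<lambda>e y. y \<in> e \<and> (\<exists>g\<in>?E. g \<noteq> e \<and> y \<in> g))"
  have "\<exists>e\<in>?E. \<exists>u v. u \<noteq> v \<and> br e u \<and> br e v"
  proof (rule ccontr)
    assume "\<not> ?thesis"
    then have uniq: "u = v" if "e \<in> ?E" "br e u" "br e v" for e u v using that by blast
    have G: "\<And>f. f \<in> ?E \<Longrightarrow> f \<subseteq> ?V \<and> f \<noteq> {}"
      using T by (auto simp: hypertree_def hypergraph_def)
    obtain y1 where y1: "y1 \<in> ?V" using T by (auto simp: hypertree_def hypergraph_def)
    have "\<not> ?V \<subseteq> {y1}" using two card_mono[of "{y1}" ?V] by auto
    then obtain y2 where y2: "y2 \<in> ?V" "y2 \<noteq> y1" by blast
    obtain t where "(y2, t) \<in> hadj ?E"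
      using hypertree_conn[OF T y2(1) y1] y2(2) by (metis converse_rtranclE)
    then obtain e0 where e0: "e0 \<in> ?E" by (auto simp: hadj_def)
    have "\<exists>z\<in>e0. (\<exists>y. br e0 y) \<longrightarrow> br e0 z"
    proof (cases "\<exists>y. br e0 y")
      case True
      then show ?thesis by (auto simp: br_def)
    qed (use G[OF e0] in blast)
    then obtain z where z: "z \<in> e0" "(\<exists>y. br e0 y) \<longrightarrow> br e0 z" by blast
    have zV: "z \<in> ?V" using z(1) G[OF e0] by blast
    \<comment> \<open>A walk that leaves the edges at \<open>z\<close> does so from an edge
      \<open>f\<close> through some \<open>y \<noteq> z\<close>, so \<open>y\<close> branches in
      \<open>f\<close>. But \<open>z\<close> branches in \<open>f\<close> too: by its choice if
      \<open>f = e0\<close>, and because of \<open>e0\<close> otherwise.\<close>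
    have reach: "\<exists>f\<in>?E. z \<in> f \<and> y \<in> f" if "(z, y) \<in> (hadj ?E)\<^sup>*" for y
      using that
    proof (induction rule: rtrancl_induct)
      case base
      then show ?case using e0 z(1) by blast
    next
      case (step y w)
      then obtain f f' where f: "f \<in> ?E" "z \<in> f" "y \<in> f" "f' \<in> ?E" "y \<in> f'" "w \<in> f'"
        by (auto simp: hadj_def)
      show ?case
      proof (cases "z \<in> f'")
        case False
        then have "f' \<noteq> f" "y \<noteq> z" using f by auto
        then have bry: "br f y" using f by (auto simp: br_def)
        have "br f z"
        proof (cases "f = e0")
          case True
          then show ?thesis using bry z(2) by blast
        next
          case False
          then show ?thesis using f z(1) e0 by (auto simp: br_def)
        qed
        then show ?thesis using uniq[OF f(1) bry] \<open>y \<noteq> z\<close> by blast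
      qed (use f in blast)
    qed
    have cover: "\<exists>f\<in>?E. z \<in> f \<and> y \<in> f" if "y \<in> ?V" for y
      using reach hypertree_conn[OF T zV that] .
    \<comment> \<open>An edge that misses \<open>z\<close> has two vertices as
      \<open>k \<ge> 2\<close>; each of them shares another edge with \<open>z\<close>, so both
      would branch.\<close>
    have through: "z \<in> f" if f: "f \<in> ?E" for f
    proof (rule ccontr)
      assume nz: "z \<notin> f"
      obtain y where y: "y \<in> f" "y \<in> ?V" using G[OF f] by blast
      obtain f1 where f1: "f1 \<in> ?E" "z \<in> f1" "y \<in> f1" using cover[OF y(2)] by blast
      have "\<not> f \<subseteq> {y}"
      proof
        assume "f \<subseteq> {y}"
        then have "card f \<le> 1" using card_mono[of "{y}" f] by simp
        then show False using unif f k by (auto simp: k_uniform_def)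
      qed
      then obtain w where w: "w \<in> f" "w \<noteq> y" by blast
      then obtain f2 where f2: "f2 \<in> ?E" "z \<in> f2" "w \<in> f2" using cover[of w] G[OF f] by blast
      have "br f y" "br f w" using y w f1 f2 nz by (auto simp: br_def)
      then show False using uniq[OF f] w by blast
    qed
    have "hg_iso T (hyperstar (card ?V) k)"
    proof (rule hyperstar_iso[OF k T unif zV through])
      show "\<exists>f\<in>?E. y \<in> f" if "y \<in> ?V" for y using cover[OF that] by blast
    qed
    with ns show False by blast
  qed
  then show ?thesis using that unfolding br_def by blast
qed

section \<open>Identification of \<open>D\<close> with the model \<open>D_hypertree\<close>\<close>

context branching
begin

lemma F_children: "(\<Union>f\<in>F. child f) = B"
  using child_F B_up by blast

lemma card_V: "card V = (k - 1) + k + card F * (k - 1)"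
proof -
  have "card B = (\<Sum>f\<in>F. card (child f))"
    unfolding F_children[symmetric]
  proof (rule card_UN_disjoint)
    show "finite F" using finite_V edge_sub by (intro finite_subset[of F "Pow V"]) (auto simp: F_def)
    show "\<forall>f\<in>F. finite (child f)" using child_sub_B finite_parts(2) finite_subset by blast
    show "\<forall>f\<in>F. \<forall>f'\<in>F. f \<noteq> f' \<longrightarrow> child f \<inter> child f' = {}" using child_F by blast
  qed
  also have "\<dots> = card F * (k - 1)" using card_child_F by simp
  finally have B: "card B = card F * (k - 1)" .
  have "V = e \<union> (P \<union> B)" "e \<inter> (P \<union> B) = {}" "P \<inter> B = {}"
    using P_outside edge_sub[OF e] by (auto simp: B_def)
  then have "card V = card e + (card P + card B)"
    using finite_parts by (metis card_Un_disjoint finite_UnI)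
  then show ?thesis using B card_parts card_edge[OF e] by simp
qed

text \<open>Three labellings are glued: a one-edge hyperstar on \<open>insert u P\<close>, a
  hyperstar on \<open>insert v B\<close> with petals indexed by \<open>F\<close>, and a numbering of
  \<open>Wd\<close>. Since \<open>D_hypertree\<close> computes the number of petals at
  \<open>v\<close> from the order, \<open>card_V\<close> has to match it with
  \<open>card F\<close>.\<close>

lemma D_iso_D_hypertree: "hg_iso D (D_hypertree (card V) k 1)"
proof -
  let ?SU = "hyperstar (1 * (k - 1) + 1) k"
  let ?SV = "hyperstar (card V - k - 1 * (k - 1) + 1) k"
  have finF: "finite F" using finite_V edge_sub by (intro finite_subset[of F "Pow V"]) (auto simp: F_def)
  have SU: "?SU = hyperstar (Suc (card {g} * (k - 1))) k" by simp
  have SV: "?SV = hyperstar (Suc (card F * (k - 1))) k" using card_V by simp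
  obtain \<psi>U where \<psi>U: "bij_betw \<psi>U (insert u P) (hverts ?SU)"
    "{\<psi>U ` insert u P} = hedges ?SU" "\<psi>U u = Center"
  proof (rule hyperstar_labelling[of k "{g}" child u])
    show "k \<ge> 2" by (rule k)
    show "u \<notin> (\<Union>f\<in>{g}. child f)" using v_notin by (simp add: P_def)
  qed (use card_parts finite_parts that SU in \<open>auto simp: P_def\<close>)
  obtain \<psi>V where \<psi>V: "bij_betw \<psi>V (insert v B) (hverts ?SV)"
    "(\<lambda>f. \<psi>V ` insert v (child f)) ` F = hedges ?SV" "\<psi>V v = Center"
  proof (rule hyperstar_labelling[of k F child v])
    show "k \<ge> 2" by (rule k)
    show "finite F" by (rule finF)
    show "v \<notin> (\<Union>f\<in>F. child f)" unfolding F_children using v_notin by blast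
    show "finite (child f) \<and> card (child f) = k - 1" if "f \<in> F" for f
      using that card_child_F child_sub_B finite_parts(2) finite_subset by blast
    show "f = f'" if "f \<in> F" "f' \<in> F" "y \<in> child f" "y \<in> child f'" for f f' y
      using that child_F by blast
  qed (use that SV F_children in simp)
  have "card Wd = k - 2" using card_edge[OF e] u v uv finite_parts by (simp add: Wd_def)
  then obtain \<omega> where \<omega>: "bij_betw \<omega> Wd {..<k - 2}"
    using ex_bij_betw_finite_nat[OF finite_parts(3)] by (auto simp: lessThan_atLeast0)
  define \<Phi> where "\<Phi> = (\<lambda>y. if y \<in> insert u P then StarU (\<psi>U y)
    else if y \<in> insert v B then StarV (\<psi>V y) else W (\<omega> y))"
  have cases: "\<And>y. y \<in> insert u P \<Longrightarrow> \<Phi> y = StarU (\<psi>U y)"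
    "\<And>y. y \<in> insert v B \<Longrightarrow> \<Phi> y = StarV (\<psi>V y)" "\<And>y. y \<in> Wd \<Longrightarrow> \<Phi> y = W (\<omega> y)"
    using v_notin uv Wd_cases by (auto simp: \<Phi>_def B_def)
  have Veq: "V = insert u P \<union> insert v B \<union> Wd" using V_eq e_eq by blast
  have "bij_betw \<Phi> (insert u P \<union> insert v B \<union> Wd)
      (StarU ` hverts ?SU \<union> StarV ` hverts ?SV \<union> W ` {..<k - 2})"
  proof (intro bij_betw_combine)
    have "bij_betw (StarU \<circ> \<psi>U) (insert u P) (StarU ` hverts ?SU)"
      by (rule bij_betw_trans[OF \<psi>U(1)]) (auto intro!: bij_betw_imageI inj_onI)
    then show "bij_betw \<Phi> (insert u P) (StarU ` hverts ?SU)"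
      by (rule bij_betw_cong[THEN iffD2, rotated]) (simp add: cases(1) del: insert_iff)
    have "bij_betw (StarV \<circ> \<psi>V) (insert v B) (StarV ` hverts ?SV)"
      by (rule bij_betw_trans[OF \<psi>V(1)]) (auto intro!: bij_betw_imageI inj_onI)
    then show "bij_betw \<Phi> (insert v B) (StarV ` hverts ?SV)"
      by (rule bij_betw_cong[THEN iffD2, rotated]) (simp add: cases(2) del: insert_iff)
    have "bij_betw (W \<circ> \<omega>) Wd (W ` {..<k - 2})"
      by (rule bij_betw_trans[OF \<omega>]) (auto intro!: bij_betw_imageI inj_onI)
    then show "bij_betw \<Phi> Wd (W ` {..<k - 2})"
      by (rule bij_betw_cong[THEN iffD2, rotated]) (simp add: cases(3))
  qed auto
  then have bij: "bij_betw \<Phi> V (StarU ` hverts ?SU \<union> StarV ` hverts ?SV \<union> W ` {..<k - 2})"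
    by (simp only: Veq[symmetric])
  have U: "(\<lambda>f. StarU ` f) ` hedges ?SU = {\<Phi> ` g}"
  proof -
    have "g = insert u P" using g(3) by (auto simp: P_eq)
    moreover have "\<Phi> ` insert u P = StarU ` \<psi>U ` insert u P"
      unfolding image_image using cases(1) by (intro image_cong) auto
    ultimately show ?thesis unfolding \<psi>U(2)[symmetric] by simp
  qed
  have Vv: "(\<lambda>f. \<Phi> ` insert v (child f)) ` F = (\<lambda>f. StarV ` f) ` hedges ?SV"
  proof -
    have "\<Phi> ` insert v (child f) = StarV ` \<psi>V ` insert v (child f)" if "f \<in> F" for f
      unfolding image_image using cases(2) child_sub_B[OF that] by (intro image_cong) auto
    then have "(\<lambda>f. \<Phi> ` insert v (child f)) ` F = (\<lambda>f. StarV ` \<psi>V ` insert v (child f)) ` F"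
      by (rule image_cong[OF refl])
    also have "\<dots> = (\<lambda>f. StarV ` f) ` (\<lambda>f. \<psi>V ` insert v (child f)) ` F"
      by (rule image_image[symmetric])
    finally show ?thesis unfolding \<psi>V(2) .
  qed
  have W: "\<Phi> ` e = {StarU Center, StarV Center} \<union> W ` {..<k - 2}"
  proof -
    have "\<Phi> ` Wd = W ` \<omega> ` Wd"
      unfolding image_image using cases(3) by (intro image_cong) auto
    moreover have "\<Phi> u = StarU Center" "\<Phi> v = StarV Center" using cases \<psi>U(3) \<psi>V(3) by auto
    ultimately show ?thesis using \<omega> by (subst e_eq) (simp add: bij_betw_def)
  qed
  have "(\<lambda>f. \<Phi> ` f) ` hedges D = insert (\<Phi> ` e) (insert (\<Phi> ` g) ((\<lambda>f. \<Phi> ` insert v (child f)) ` F))"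
    by (simp add: D_def image_image)
  also have "\<dots> = (\<lambda>f. StarU ` f) ` hedges ?SU \<union> (\<lambda>f. StarV ` f) ` hedges ?SV
      \<union> {{StarU Center, StarV Center} \<union> W ` {..<k - 2}}"
    unfolding U Vv W by blast
  finally show ?thesis
    unfolding hg_iso_def D_hypertree_def Let_def using bij by (intro exI[of _ \<Phi>]) simp
qed

end

theorem theorem4p5:
  fixes T :: "'a hypergraph" and k n :: nat
  assumes "k \<ge> 2"
    and "hypertree T"
    and "k_uniform k T"
    and "card (hverts T) = n"
    and "\<not> hg_iso T (hyperstar n k)"
    and "(real n - 1) / (real k - 1) \<ge> 3"
  shows "distance_spectral_radius T \<ge> distance_spectral_radius (D_hypertree n k 1) \<and>
    (distance_spectral_radius T = distance_spectral_radius (D_hypertree n k 1) \<longleftrightarrow>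
       hg_iso T (D_hypertree n k 1))"
proof -
  have "3 * (real k - 1) \<le> real n - 1" "real k \<ge> 2" using assms(1,6) by (simp_all add: pos_le_divide_eq)
  then have "real n \<ge> 2" by argo
  then have "n \<ge> 2" by simp
  then obtain e u v g h where b: "e \<in> hedges T" "u \<in> e" "v \<in> e" "u \<noteq> v"
    "g \<in> hedges T" "g \<noteq> e" "u \<in> g" "h \<in> hedges T" "h \<noteq> e" "v \<in> h"
    using not_hyperstar_branching[OF assms(1-3)] assms(4,5) by metis
  interpret edge_rooted T e using assms(2) b(1) by unfold_locales
  \<comment> \<open>The two ends found in \<open>e\<close> play symmetric roles until their branches
    are compared; the smaller one is called \<open>u\<close>, and the edge left in place there is
    \<open>g\<close> or \<open>h\<close> accordingly.\<close>
  have "\<exists>u v g. branching T e k u v g"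
  proof (cases "card {y \<in> V - e. root y = u} \<le> card {y \<in> V - e. root y = v}")
    case True
    then have "branching T e k u v g" using b assms(1,3) by unfold_locales auto
    then show ?thesis by blast
  next
    case False
    then have "branching T e k v u h" using b assms(1,3) by unfold_locales auto
    then show ?thesis by blast
  qed
  then obtain u v g where "branching T e k u v g" by blast
  then interpret branching T e k u v g .
  have "hg_iso D (D_hypertree n k 1)" using D_iso_D_hypertree assms(4) by simp
  moreover from this have "distance_spectral_radius D = distance_spectral_radius (D_hypertree n k 1)"
    by (rule distance_spectral_radius_iso[OF hypergraph_D])
  ultimately show ?thesis
    using distance_spectral_radius_D_le distance_spectral_radius_iso[OF hyper] by metis
qed

end
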